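(* Let $(\Phi,\mathbb P)$ be a stationary point process on $\mathbb R^d$ with finite and positive intensity, and let $F$ be a (flow-adapted) point-shift. Then, $\mathbb P$-almost surely, each connected component $C$ of the graph $G^F(\Phi)$ is in one of the three following classes: 1. Class $\mathcal F/\mathcal F$: $C$ is finite, and hence so is each of its $F$-foils. In this case, denoting by $1\le n=n(C)<\infty$ the number of foils of $C$: $C$ has a unique cycle, which has length $n$; and $F^\infty(C)$ is the set of vertices of this cycle. 2. Class $\mathcal I/\mathcal F$: $C$ is infinite and each of its $F$-foils is finite. In this case: $C$ is acyclic; each foil $L$ of $C$ has a junior foil, i.e. there is a foil $L'$ of $C$ such that $F_\Phi(y)\in L$ for all $y\in L'$; and $F^\infty(C)$ is a unique bi-infinite path, i.e. it is the set of points of a sequence $(x_n)_{n\in\mathbb Z}$ of points of $\Phi$ with $F_\Phi(x_n)=x_{n+1}$ for all $n\in\mathbb Z$. 3. Class $\mathcal I/\mathcal I$: $C$ is infinite and all its $F$-foils are infinite. In this case: $C$ is acyclic; and $F^\infty(C)=\emptyset$.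
   Context: $\mathbf N$ is the space of locally finite simple counting measures on $\mathbb R^d$ with the $\sigma$-field generated by $\phi\mapsto\phi(B)$, $B$ Borel; $\phi\in\mathbf N$ is identified with its support. $\mathbf N^0\subset\mathbf N$ is the set of $\phi$ with an atom at $0$. The translation flow is $(\theta_t\phi)(B)=\phi(B+t)$ and $\theta_t x=x-t$. The group $\mathbb R^d$ also acts on the probability space by $\theta_t$; a stationary point process is a pair $(\Phi,\mathbb P)$ where $\mathbb P$ is invariant under all $\theta_t$ and $\Phi:\Omega\to\mathbf N$ is measurable with $\Phi(\theta_t\omega)=\theta_t\Phi(\omega)$. A point-map is a measurable $f:\mathbf N^0\to\mathbb R^d$ with $f(\phi)\in\phi$; the associated (flow-adapted) point-shift is $F_\phi(x)=f(\theta_x\phi)+x$ for $\phi\in\mathbf N$, $x\in\phi$, so $F_\phi$ maps $\phi$ to $\phi$. All point-shifts are of this form. $G^F(\phi)$ is the graph with vertex set $\phi$ and an edge $(x,F_\phi(x))$ for each $x\in\phi$. The connected component of $x$ is the set of $y\in\phi$ such that $F_\phi^m(x)=F_\phi^n(y)$ for some $m,n\ge 0$. The $F$-foils are the classes of the equivalence relation $x\sim_F y\iff \exists n\in\mathbb N,\ F_\phi^n(x)=F_\phi^n(y)$; each component is a union of foils. A cycle is a directed cycle (fixed points count as cycles of length $1$, and 2-cycles of $F_\phi$ as cycles of length 2); a component is acyclic if the restriction of the graph to it is a tree, i.e. it contains no directed cycle. For a component $C$, $F^\infty(C)=\bigcap_{n\ge0}F_\phi^n(C)$. *)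

theory Defs
  imports "HOL-Probability.Probability" "Graph_Theory.Digraph_Component"
begin

text \<open>
  A locally finite simple counting measure on the Euclidean space \<^typ>\<open>'a\<close> is identified with its
  support, a locally finite set of points \<open>\<phi>\<close>; its value on a set \<open>B\<close> is \<open>point_count \<phi> B\<close>, the
  number of points of \<open>\<phi>\<close> in \<open>B\<close>. The measurable space \<open>config_space\<close> carries the sigma-field
  generated by the maps \<open>\<phi> \<mapsto> point_count \<phi> B\<close> with \<open>B\<close> Borel (its measure component is irrelevant).
\<close>

definition configs :: "'a::euclidean_space set set" where
  "configs = {\<phi>. \<forall>B. bounded B \<longrightarrow> finite (\<phi> \<inter> B)}"

definition point_count :: "'a::euclidean_space set \<Rightarrow> 'a set \<Rightarrow> ennreal" where
  "point_count \<phi> B = emeasure (count_space UNIV) (\<phi> \<inter> B)"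

definition config_space :: "'a::euclidean_space set measure" where
  "config_space = sigma configs
     {{\<phi> \<in> configs. point_count \<phi> B \<in> A} | B A. B \<in> sets borel \<and> A \<in> sets borel}"

definition configs0 :: "'a::euclidean_space set set" where
  "configs0 = {\<phi> \<in> configs. 0 \<in> \<phi>}"

definition translate :: "'a::euclidean_space \<Rightarrow> 'a set \<Rightarrow> 'a set" where
  "translate t \<phi> = (\<lambda>x. x - t) ` \<phi>"

lemma point_count_translate: "point_count (translate t \<phi>) B = point_count \<phi> ((\<lambda>x. x + t) ` B)"
proof -
  have "bij_betw (\<lambda>x. x - t) (\<phi> \<inter> (\<lambda>x. x + t) ` B) (translate t \<phi> \<inter> B)"
    by (rule bij_betw_byWitness[where f' = "\<lambda>x. x + t"]) (auto simp: translate_def)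
  then show ?thesis
    unfolding point_count_def
    by (simp add: emeasure_count_space bij_betw_finite bij_betw_same_card)
qed

text \<open>
  The action \<open>\<theta>\<close> of the additive group \<^typ>\<open>'a\<close> on the underlying probability space is only
  required to consist of measurable maps; joint measurability in the group parameter is not
  imposed.
\<close>

locale stationary_point_process = prob_space M
  for M :: "'w measure"
    and \<theta> :: "'a::euclidean_space \<Rightarrow> 'w \<Rightarrow> 'w"
    and \<Phi> :: "'w \<Rightarrow> 'a set" +
  assumes flow_measurable: "\<theta> t \<in> measurable M M"
    and flow_zero: "\<omega> \<in> space M \<Longrightarrow> \<theta> 0 \<omega> = \<omega>"
    and flow_add: "\<omega> \<in> space M \<Longrightarrow> \<theta> (s + t) \<omega> = \<theta> s (\<theta> t \<omega>)"
    and flow_invariant: "distr M M (\<theta> t) = M"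
    and process_measurable: "\<Phi> \<in> measurable M config_space"
    and process_adapted: "\<omega> \<in> space M \<Longrightarrow> \<Phi> (\<theta> t \<omega>) = translate t (\<Phi> \<omega>)"

text \<open>
  By stationarity the expected number of points in a Borel set \<open>B\<close> is a constant multiple of the
  Lebesgue measure of \<open>B\<close>; the constant is the value for the half-open unit cube.
\<close>

definition intensity :: "'w measure \<Rightarrow> ('w \<Rightarrow> 'a::euclidean_space set) \<Rightarrow> ennreal" where
  "intensity M \<Phi> = (\<integral>\<^sup>+ \<omega>. point_count (\<Phi> \<omega>) {x. \<forall>b\<in>Basis. 0 \<le> x \<bullet> b \<and> x \<bullet> b < 1} \<partial>M)"

definition point_map :: "('a::euclidean_space set \<Rightarrow> 'a) \<Rightarrow> bool" where
  "point_map f \<longleftrightarrow>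
     f \<in> measurable (restrict_space config_space configs0) borel \<and> (\<forall>\<phi>\<in>configs0. f \<phi> \<in> \<phi>)"

definition point_shift :: "('a::euclidean_space set \<Rightarrow> 'a) \<Rightarrow> 'a set \<Rightarrow> 'a \<Rightarrow> 'a" where
  "point_shift f \<phi> x = f (translate x \<phi>) + x"

lemma translate_configs:
  assumes "\<phi> \<in> configs"
  shows "translate t \<phi> \<in> configs"
proof -
  have "finite (translate t \<phi> \<inter> B)" if "bounded B" for B
  proof -
    have "bounded ((\<lambda>x. x + t) ` B)"
      using bounded_translation[OF that, of t] by (simp add: add.commute)
    then have "finite (\<phi> \<inter> (\<lambda>x. x + t) ` B)"
      using assms by (simp add: configs_def)
    moreover have "translate t \<phi> \<inter> B \<subseteq> (\<lambda>x. x - t) ` (\<phi> \<inter> (\<lambda>x. x + t) ` B)"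
      by (auto simp: translate_def image_iff) (metis diff_add_cancel)
    ultimately show ?thesis
      by (meson finite_imageI finite_subset)
  qed
  then show ?thesis by (simp add: configs_def)
qed

lemma point_shift_in:
  assumes "point_map f" "\<phi> \<in> configs" "x \<in> \<phi>"
  shows "point_shift f \<phi> x \<in> \<phi>"
proof -
  have "translate x \<phi> \<in> configs0"
    using assms translate_configs[of \<phi> x] by (auto simp: configs0_def translate_def)
  then have "f (translate x \<phi>) \<in> translate x \<phi>"
    using assms by (auto simp: point_map_def)
  then show ?thesis
    by (auto simp: point_shift_def translate_def)
qed

definition shift_graph ::
  "('a::euclidean_space set \<Rightarrow> 'a) \<Rightarrow> 'a set \<Rightarrow> ('a, 'a \<times> 'a) pre_digraph" where
  "shift_graph f \<phi> =
     \<lparr> verts = \<phi>, arcs = {(x, point_shift f \<phi> x) | x. x \<in> \<phi>}, tail = fst, head = snd \<rparr>"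

definition component_rel :: "('a::euclidean_space set \<Rightarrow> 'a) \<Rightarrow> 'a set \<Rightarrow> ('a \<times> 'a) set" where
  "component_rel f \<phi> = {(x, y). x \<in> \<phi> \<and> y \<in> \<phi> \<and>
     (\<exists>m n. (point_shift f \<phi> ^^ m) x = (point_shift f \<phi> ^^ n) y)}"

definition shift_components :: "('a::euclidean_space set \<Rightarrow> 'a) \<Rightarrow> 'a set \<Rightarrow> 'a set set" where
  "shift_components f \<phi> = \<phi> // component_rel f \<phi>"

definition foil_rel :: "('a::euclidean_space set \<Rightarrow> 'a) \<Rightarrow> 'a set \<Rightarrow> ('a \<times> 'a) set" where
  "foil_rel f \<phi> = {(x, y). x \<in> \<phi> \<and> y \<in> \<phi> \<and>
     (\<exists>n. (point_shift f \<phi> ^^ n) x = (point_shift f \<phi> ^^ n) y)}"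

definition foils_of :: "('a::euclidean_space set \<Rightarrow> 'a) \<Rightarrow> 'a set \<Rightarrow> 'a set \<Rightarrow> 'a set set" where
  "foils_of f \<phi> C = {L \<in> \<phi> // foil_rel f \<phi>. L \<subseteq> C}"

text \<open>
  The library's cycles are closed walks, given by their lists of arcs, without repeated vertices;
  loops and cycles of length 2 are included, as they have to be.
\<close>

definition is_cycle_of ::
  "('a::euclidean_space set \<Rightarrow> 'a) \<Rightarrow> 'a set \<Rightarrow> 'a set \<Rightarrow> ('a \<times> 'a) list \<Rightarrow> bool" where
  "is_cycle_of f \<phi> C p \<longleftrightarrow> pre_digraph.cycle (shift_graph f \<phi> \<restriction> C) p"

definition acyclic_component :: "('a::euclidean_space set \<Rightarrow> 'a) \<Rightarrow> 'a set \<Rightarrow> 'a set \<Rightarrow> bool" where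
  "acyclic_component f \<phi> C \<longleftrightarrow> (\<nexists>p. is_cycle_of f \<phi> C p)"

definition F_infinity :: "('a::euclidean_space set \<Rightarrow> 'a) \<Rightarrow> 'a set \<Rightarrow> 'a set \<Rightarrow> 'a set" where
  "F_infinity f \<phi> C = (\<Inter>n. (point_shift f \<phi> ^^ n) ` C)"

definition bi_infinite_path ::
  "('a::euclidean_space set \<Rightarrow> 'a) \<Rightarrow> 'a set \<Rightarrow> (int \<Rightarrow> 'a) \<Rightarrow> bool" where
  "bi_infinite_path f \<phi> x \<longleftrightarrow>
     (\<forall>n. x n \<in> \<phi>) \<and> (\<forall>n. point_shift f \<phi> (x n) = x (n + 1))"

definition class_FF :: "('a::euclidean_space set \<Rightarrow> 'a) \<Rightarrow> 'a set \<Rightarrow> 'a set \<Rightarrow> bool" where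
  "class_FF f \<phi> C \<longleftrightarrow> finite C"

definition class_IF :: "('a::euclidean_space set \<Rightarrow> 'a) \<Rightarrow> 'a set \<Rightarrow> 'a set \<Rightarrow> bool" where
  "class_IF f \<phi> C \<longleftrightarrow> infinite C \<and> (\<forall>L\<in>foils_of f \<phi> C. finite L)"

definition class_II :: "('a::euclidean_space set \<Rightarrow> 'a) \<Rightarrow> 'a set \<Rightarrow> 'a set \<Rightarrow> bool" where
  "class_II f \<phi> C \<longleftrightarrow> infinite C \<and> (\<forall>L\<in>foils_of f \<phi> C. infinite L)"

end

theory Submission
  imports Defs
begin

text \<open>
  For a fixed map \<open>F\<close> of a set to itself, everything the theorem claims about finite
  components is combinatorics, and so is everything about infinite ones once a few degenerate
  situations are excluded. These are gathered in the locale \<open>regular_map\<close>; the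
  probabilistic part of the proof shows that almost every configuration is regular
  (\<open>AE_regular_map\<close>).

  Each degenerate situation is excluded by the mass transport principle
  (\<open>mass_transport\<close>): if every point of the configuration sends unit masses to points
  of the configuration, following a measurable rule that commutes with translations, then the
  expected mass sent out of a unit cube equals the expected mass it receives. Since the intensity is
  finite, a rule under which each point sends a bounded mass almost surely lets no point receive an
  infinite mass (\<open>AE_finite_in_degree\<close>). Two consequences carry the argument. First, an
  infinite component has no distinguished nonempty finite subset, as otherwise all its points could
  send mass to that subset (\<open>AE_no_finite_selection\<close>). Second, if \<open>F\<close> maps
  a distinguished set of points onto itself, then it is injective on it, as otherwise more mass
  would be received than sent (\<open>AE_inj_of_surj\<close>).

  In an infinite component, the points of a cycle would be a distinguished finite set, so there is
  no cycle. Almost surely every point has finitely many preimages, hence an infinite foil is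
  followed only by infinite foils; a finite foil followed by an infinite one would be the last
  finite foil of its component, a distinguished finite set, so finite and infinite foils do not
  coexist. Likewise a finite foil without a junior foil would be the first foil of its component.
  Finally call a point ancient if it has preimages of all orders; the ancient points of a component
  \<open>C\<close> form \<open>F\<^sup>\<infinity>(C)\<close>. By Koenig's lemma \<open>F\<close>
  maps the ancient points onto themselves, hence injectively, so that a foil has at most one ancient
  point. If a foil has one, all its points could send unit mass there, so the foil is finite: there
  are no ancient points when the foils are infinite. When they are finite, the existence of junior
  foils and compactness provide an ancient point, and its orbit in both directions is the
  bi-infinite path.

  Measurability is handled by enumerating the points of a configuration measurably. A property of
  one or two points is then measurable if it is so at all enumerated points, and quantification over
  the points becomes countable.
\<close>

section \<open>Orbits of a self-map\<close>

definition connected_by :: "('a \<Rightarrow> 'a) \<Rightarrow> 'a \<Rightarrow> 'a \<Rightarrow> bool" where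
  "connected_by F x y \<longleftrightarrow> (\<exists>m n. (F ^^ m) x = (F ^^ n) y)"

definition coalesce :: "('a \<Rightarrow> 'a) \<Rightarrow> 'a \<Rightarrow> 'a \<Rightarrow> bool" where
  "coalesce F x y \<longleftrightarrow> (\<exists>n. (F ^^ n) x = (F ^^ n) y)"

text \<open>
  The points with preimages of every order. An ancient point need not have an infinite backward path
  in general; it has one if all fibres of the map are finite.
\<close>

definition ancient :: "'a set \<Rightarrow> ('a \<Rightarrow> 'a) \<Rightarrow> 'a \<Rightarrow> bool" where
  "ancient V F y \<longleftrightarrow> (\<forall>n. \<exists>z\<in>V. (F ^^ n) z = y)"

definition foil :: "'a set \<Rightarrow> ('a \<Rightarrow> 'a) \<Rightarrow> 'a \<Rightarrow> 'a set" where
  "foil V F x = {y \<in> V. coalesce F x y}"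

definition component :: "'a set \<Rightarrow> ('a \<Rightarrow> 'a) \<Rightarrow> 'a \<Rightarrow> 'a set" where
  "component V F x = {y \<in> V. connected_by F x y}"

lemma funpow_plus: "(F ^^ m) ((F ^^ n) x) = (F ^^ (m + n)) x"
  by (simp add: funpow_add)

lemma connected_by_refl: "connected_by F x x"
  unfolding connected_by_def by blast

lemma connected_by_sym: "connected_by F x y \<Longrightarrow> connected_by F y x"
  unfolding connected_by_def by metis

lemma connected_by_trans [trans]:
  assumes "connected_by F x y" "connected_by F y z" shows "connected_by F x z"
proof -
  obtain m n p q where "(F ^^ m) x = (F ^^ n) y" "(F ^^ p) y = (F ^^ q) z"
    using assms unfolding connected_by_def by blast
  then have "(F ^^ (p + m)) x = (F ^^ (n + q)) z"
    by (metis add.commute funpow_plus)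
  then show ?thesis unfolding connected_by_def by blast
qed

lemma coalesce_refl: "coalesce F x x"
  unfolding coalesce_def by blast

lemma coalesce_sym: "coalesce F x y \<Longrightarrow> coalesce F y x"
  unfolding coalesce_def by metis

lemma coalesce_trans:
  assumes "coalesce F x y" "coalesce F y z" shows "coalesce F x z"
proof -
  obtain m n where "(F ^^ m) x = (F ^^ m) y" "(F ^^ n) y = (F ^^ n) z"
    using assms unfolding coalesce_def by blast
  then have "(F ^^ (n + m)) x = (F ^^ (n + m)) z"
    by (metis add.commute funpow_plus)
  then show ?thesis unfolding coalesce_def by blast
qed

lemma coalesce_imp_connected_by: "coalesce F x y \<Longrightarrow> connected_by F x y"
  unfolding coalesce_def connected_by_def by blast

lemma coalesce_funpow: "coalesce F x y \<Longrightarrow> coalesce F ((F ^^ k) x) ((F ^^ k) y)"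
  unfolding coalesce_def by (metis add.commute funpow_plus)

lemma coalesce_step: "coalesce F x y \<Longrightarrow> coalesce F (F x) (F y)"
  using coalesce_funpow[of F x y 1] by simp

lemma connected_by_funpow: "connected_by F x ((F ^^ k) x)"
  unfolding connected_by_def by (metis funpow_0)

text \<open>
  Cancelling the common number of steps, one of two connected points coalesces with an iterate of
  the other one. This replaces numbering the foils of a component by integers, which is possible
  only in the absence of cycles.
\<close>

lemma connected_by_cases:
  assumes "connected_by F x y"
  obtains k where "coalesce F x ((F ^^ k) y)" | k where "coalesce F ((F ^^ k) x) y"
proof -
  obtain a b where ab: "(F ^^ a) x = (F ^^ b) y"
    using assms unfolding connected_by_def by blast
  show ?thesis
  proof (cases "a \<le> b")
    case True
    then have "(F ^^ a) x = (F ^^ a) ((F ^^ (b - a)) y)"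
      using ab by (simp add: funpow_plus)
    then show ?thesis using that(1) unfolding coalesce_def by blast
  next
    case False
    then have "(F ^^ b) ((F ^^ (a - b)) x) = (F ^^ b) y"
      using ab by (simp add: funpow_plus)
    then show ?thesis using that(2) unfolding coalesce_def by blast
  qed
qed

text \<open>
  Koenig's lemma in the form of compactness: a decreasing sequence of nonempty subsets of a finite
  set has a common element.
\<close>

lemma finite_decreasing_witness:
  fixes Q :: "nat \<Rightarrow> 'a \<Rightarrow> bool"
  assumes "finite P" and ex: "\<And>n. \<exists>x\<in>P. Q n x" and dec: "\<And>n x. Q (Suc n) x \<Longrightarrow> Q n x"
  shows "\<exists>x\<in>P. \<forall>n. Q n x"
proof (rule ccontr)
  assume "\<not> ?thesis"
  then obtain g where g: "\<And>x. x \<in> P \<Longrightarrow> \<not> Q (g x) x" by metis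
  have le: "Q m x" if "m \<le> n" "Q n x" for m n x
    using that by (induction rule: dec_induct) (auto intro: dec)
  obtain x where x: "x \<in> P" "Q (Max (g ` P)) x" using ex by blast
  then have "g x \<le> Max (g ` P)" using assms(1) by simp
  then show False using le g x by blast
qed

text \<open>
  Two cycles in one component coincide: the second cyclic point returns to itself after arbitrarily
  many steps, and by then it has run into the first cycle.
\<close>

lemma cycle_index:
  assumes c: "(F ^^ p) c = c" "0 < p" and u: "(F ^^ n) u = u" "0 < n" and "connected_by F c u"
  shows "\<exists>k<p. u = (F ^^ k) c"
proof -
  obtain a b where ab: "(F ^^ a) c = (F ^^ b) u"
    using assms(5) unfolding connected_by_def by blast
  have "u = (F ^^ (b * n)) u"
    using funpow_mod_eq[OF u(1), of "b * n"] by simp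
  also have "b * n = (b * n - b) + b"
    using u(2) by simp
  also have "(F ^^ ((b * n - b) + b)) u = (F ^^ (b * n - b)) ((F ^^ b) u)"
    by (simp only: funpow_plus)
  also have "\<dots> = (F ^^ (b * n - b + a)) c"
    by (simp only: ab[symmetric] funpow_plus)
  also have "\<dots> = (F ^^ ((b * n - b + a) mod p)) c"
    using funpow_mod_eq[OF c(1)] by simp
  finally show ?thesis
    using c(2) by (intro exI[of _ "(b * n - b + a) mod p"]) simp
qed

locale self_map =
  fixes V :: "'a set" and F :: "'a \<Rightarrow> 'a"
  assumes closed: "x \<in> V \<Longrightarrow> F x \<in> V"
begin

lemma funpow_closed: "x \<in> V \<Longrightarrow> (F ^^ n) x \<in> V"
  by (induction n) (auto intro: closed)

lemma component_eq:
  assumes "connected_by F x y" shows "component V F x = component V F y"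
proof -
  have "connected_by F x z \<longleftrightarrow> connected_by F y z" for z
    using assms connected_by_trans[of F x y z] connected_by_trans[of F y x z] connected_by_sym[of F x y]
    by blast
  then show ?thesis by (simp add: component_def)
qed

lemma foil_eq:
  assumes "coalesce F x y" shows "foil V F x = foil V F y"
proof -
  have "coalesce F x z \<longleftrightarrow> coalesce F y z" for z
    using assms coalesce_trans[of F x y z] coalesce_trans[of F y x z] coalesce_sym[of F x y]
    by blast
  then show ?thesis by (simp add: foil_def)
qed

lemma foil_self: "x \<in> V \<Longrightarrow> x \<in> foil V F x"
  unfolding foil_def by (simp add: coalesce_refl)

lemma foil_subset_component: "foil V F x \<subseteq> component V F x"
  unfolding foil_def component_def by (auto intro: coalesce_imp_connected_by)

lemma component_self: "x \<in> V \<Longrightarrow> x \<in> component V F x"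
  unfolding component_def by (simp add: connected_by_refl)

lemma component_subset: "component V F x \<subseteq> V"
  unfolding component_def by blast

lemma component_step:
  assumes "y \<in> component V F x" shows "F y \<in> component V F x"
proof -
  have "connected_by F x y" using assms by (simp add: component_def)
  also have "connected_by F y (F y)" using connected_by_funpow[of F y 1] by simp
  finally show ?thesis using assms closed by (simp add: component_def)
qed

lemma ancient_in: "ancient V F y \<Longrightarrow> y \<in> V"
  unfolding ancient_def using funpow_closed by metis

lemma ancient_step: "ancient V F y \<Longrightarrow> ancient V F (F y)"
  unfolding ancient_def
proof
  fix n assume "\<forall>n. \<exists>z\<in>V. (F ^^ n) z = y"
  then obtain z where "z \<in> V" "(F ^^ n) z = y" by blast
  then have "F z \<in> V \<and> (F ^^ n) (F z) = F y" by (metis closed funpow_swap1)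
  then show "\<exists>z\<in>V. (F ^^ n) z = F y" by blast
qed

lemma ancient_funpow: "ancient V F y \<Longrightarrow> ancient V F ((F ^^ n) y)"
  by (induction n) (auto intro: ancient_step)

lemma ancient_cyclic:
  assumes "y \<in> V" "(F ^^ n) y = y" "0 < n"
  shows "ancient V F y"
  unfolding ancient_def
proof
  fix k
  have "(F ^^ k) ((F ^^ (k * n - k)) y) = (F ^^ (k * n)) y"
    using assms(3) by (simp add: funpow_plus)
  also have "\<dots> = y"
    using funpow_mod_eq[OF assms(2), of "k * n"] by simp
  finally show "\<exists>z\<in>V. (F ^^ k) z = y"
    using funpow_closed[OF assms(1)] by blast
qed

text \<open>
  One of the finitely many preimages of an ancient point must be the last step of paths of unbounded
  length.
\<close>

lemma image_ancient:
  assumes "\<And>y. y \<in> V \<Longrightarrow> finite {x \<in> V. F x = y}"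
  shows "F ` {y \<in> V. ancient V F y} = {y \<in> V. ancient V F y}"
proof (intro equalityI subsetI)
  fix y assume "y \<in> F ` {y \<in> V. ancient V F y}"
  then show "y \<in> {y \<in> V. ancient V F y}" by (auto intro: closed ancient_step)
next
  fix y assume "y \<in> {y \<in> V. ancient V F y}"
  then have y: "y \<in> V" "ancient V F y" by auto
  have "\<exists>x\<in>{x \<in> V. F x = y}. \<forall>n. \<exists>z\<in>V. (F ^^ n) z = x"
  proof (rule finite_decreasing_witness[OF assms[OF y(1)]])
    fix n
    obtain z where "z \<in> V" "(F ^^ Suc n) z = y" using y(2) unfolding ancient_def by blast
    then show "\<exists>x\<in>{x \<in> V. F x = y}. \<exists>z\<in>V. (F ^^ n) z = x"
      using funpow_closed by auto
  next
    fix n x assume "\<exists>z\<in>V. (F ^^ Suc n) z = x"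
    then obtain z where "z \<in> V" "(F ^^ n) (F z) = x" by (auto simp: funpow_swap1)
    then show "\<exists>z\<in>V. (F ^^ n) z = x" using closed by blast
  qed
  then obtain x where "x \<in> V" "F x = y" "ancient V F x" unfolding ancient_def by blast
  then show "y \<in> F ` {y \<in> V. ancient V F y}" by blast
qed

end

text \<open>
  The almost sure properties of a point-shift on which the classification rests. The assumption
  \<open>finite_foil_of_lone_ancient\<close> records that a foil cannot send its mass to a single
  point if it is infinite. The last three assumptions are instances of one principle, namely that no
  infinite component has a distinguished nonempty finite subset. The distinguished points are, in
  turn, the points on cycles, those of the last finite foil, and those of a finite foil that is not
  preceded by another one.
\<close>

locale regular_map = self_map +
  assumes finite_fibres: "y \<in> V \<Longrightarrow> finite {x \<in> V. F x = y}"
    and inj_ancient: "inj_on F {y \<in> V. ancient V F y}"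
    and finite_foil_of_lone_ancient:
      "y \<in> V \<Longrightarrow> ancient V F y \<Longrightarrow> (\<And>z. z \<in> V \<Longrightarrow> coalesce F y z \<Longrightarrow> ancient V F z \<Longrightarrow> z = y) \<Longrightarrow> finite (foil V F y)"
    and no_cycle: "x \<in> V \<Longrightarrow> infinite (component V F x) \<Longrightarrow> \<exists>n. (F ^^ Suc n) x = x \<Longrightarrow>
      infinite {y \<in> component V F x. \<exists>n. (F ^^ Suc n) y = y}"
    and no_last_finite_foil: "x \<in> V \<Longrightarrow> infinite (component V F x) \<Longrightarrow>
      finite (foil V F x) \<and> infinite (foil V F (F x)) \<Longrightarrow>
      infinite {y \<in> component V F x. finite (foil V F y) \<and> infinite (foil V F (F y))}"
    and no_first_foil: "x \<in> V \<Longrightarrow> infinite (component V F x) \<Longrightarrow>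
      finite (foil V F x) \<and> \<not> (\<exists>z\<in>V. coalesce F x (F z)) \<Longrightarrow>
      infinite {y \<in> component V F x. finite (foil V F y) \<and> \<not> (\<exists>z\<in>V. coalesce F y (F z))}"
begin

lemma inj_funpow_ancient:
  assumes "ancient V F x" "ancient V F y" "(F ^^ n) x = (F ^^ n) y"
  shows "x = y"
  using assms
proof (induction n)
  case (Suc n)
  then have "F ((F ^^ n) x) = F ((F ^^ n) y)" by simp
  then have "(F ^^ n) x = (F ^^ n) y"
    by (rule inj_onD[OF inj_ancient])
      (simp_all add: ancient_funpow ancient_in Suc.prems)
  then show ?case using Suc by blast
qed simp

lemma coalesce_ancient_eq: "ancient V F x \<Longrightarrow> ancient V F y \<Longrightarrow> coalesce F x y \<Longrightarrow> x = y"
  unfolding coalesce_def using inj_funpow_ancient by blast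

text \<open>
  By injectivity of \<open>F\<close> on ancient points, an ancient point is alone in its foil.
\<close>

lemma finite_foil_ancient: "ancient V F y \<Longrightarrow> finite (foil V F y)"
  using finite_foil_of_lone_ancient coalesce_ancient_eq ancient_in by metis

lemma infinite_component_acyclic:
  assumes x: "x \<in> V" "infinite (component V F x)" and "y \<in> component V F x" "0 < n"
  shows "(F ^^ n) y \<noteq> y"
proof
  assume y: "(F ^^ n) y = y"
  have yV: "y \<in> V" and "connected_by F x y" using assms(3) by (auto simp: component_def)
  then have C: "component V F x = component V F y" by (simp add: component_eq)
  have "\<exists>n. (F ^^ Suc n) y = y"
    using y assms(4) by (metis Suc_pred)
  then have "infinite {z \<in> component V F y. \<exists>n. (F ^^ Suc n) z = z}"
    using no_cycle[OF yV] x(2) C by simp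
  moreover have "{z \<in> component V F y. \<exists>n. (F ^^ Suc n) z = z} \<subseteq> (\<lambda>k. (F ^^ k) y) ` {..<n}"
  proof
    fix z assume "z \<in> {z \<in> component V F y. \<exists>n. (F ^^ Suc n) z = z}"
    then obtain m where "(F ^^ Suc m) z = z" "connected_by F y z" by (auto simp: component_def)
    then obtain k where "k < n" "z = (F ^^ k) y"
      using cycle_index[OF y assms(4) \<open>(F ^^ Suc m) z = z\<close>] by blast
    then show "z \<in> (\<lambda>k. (F ^^ k) y) ` {..<n}" by blast
  qed
  ultimately show False using finite_surj by blast
qed

lemma infinite_foil_step:
  assumes "infinite (foil V F w)" shows "infinite (foil V F (F w))"
proof
  assume fin: "finite (foil V F (F w))"
  have "foil V F w \<subseteq> (\<Union>u\<in>foil V F (F w). {x \<in> V. F x = u})"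
    by (auto simp: foil_def closed intro: coalesce_step)
  moreover have "finite (\<Union>u\<in>foil V F (F w). {x \<in> V. F x = u})"
    using fin by (intro finite_UN_I finite_fibres) (auto simp: foil_def)
  ultimately show False using assms finite_subset by blast
qed

lemma infinite_foil_funpow: "infinite (foil V F w) \<Longrightarrow> infinite (foil V F ((F ^^ n) w))"
  by (induction n) (auto dest: infinite_foil_step)

text \<open>
  Along the orbit of a point in a finite foil, finite foils may be followed by infinite ones but not
  conversely. If the component also had an infinite foil there would be a last finite foil, which is
  unique and hence a distinguished finite set.
\<close>

lemma foils_alike:
  assumes x: "x \<in> V" "infinite (component V F x)" and y: "y \<in> component V F x" and z: "z \<in> component V F x"
    and "finite (foil V F y)"
  shows "finite (foil V F z)"
proof (rule ccontr)
  assume z_inf: "infinite (foil V F z)"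
  have "connected_by F y z"
    using y z connected_by_sym[of F x y] connected_by_trans[of F y x z] by (simp add: component_def)
  then obtain m n where "(F ^^ m) y = (F ^^ n) z" unfolding connected_by_def by blast
  then have "infinite (foil V F ((F ^^ m) y))" using infinite_foil_funpow[OF z_inf, of n] by simp
  then obtain k where k: "infinite (foil V F ((F ^^ k) y))" "\<forall>j<k. finite (foil V F ((F ^^ j) y))"
    using exists_least_iff[of "\<lambda>k. infinite (foil V F ((F ^^ k) y))"] by blast
  with assms(5) obtain j where j: "k = Suc j" by (cases k) auto
  define w where "w = (F ^^ j) y"
  have w: "w \<in> V" "finite (foil V F w)" "infinite (foil V F (F w))"
    using k j y funpow_closed by (auto simp: w_def component_def)
  have "connected_by F x y" using y by (simp add: component_def)
  also have "connected_by F y w" by (simp add: w_def connected_by_funpow)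
  finally have C: "component V F x = component V F w" by (rule component_eq)
  let ?S = "{u \<in> component V F w. finite (foil V F u) \<and> infinite (foil V F (F u))}"
  \<comment> \<open>behind an infinite foil there are only infinite ones, so no other foil of \<open>?S\<close> can follow\<close>
  have late: "k = 0" if "infinite (foil V F (F u))" "finite (foil V F ((F ^^ k) u))" for u k
  proof (rule ccontr)
    assume "k \<noteq> 0"
    then obtain i where "k = Suc i" by (cases k) auto
    then have "(F ^^ k) u = (F ^^ i) (F u)" by (simp add: funpow_swap1)
    then show False using infinite_foil_funpow[OF that(1), of i] that(2) by simp
  qed
  have "?S \<subseteq> foil V F w"
  proof
    fix u assume u: "u \<in> ?S"
    then have "connected_by F w u" by (simp add: component_def)
    then have "coalesce F w u"
    proof (cases rule: connected_by_cases)
      case (1 k)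
      then have "k = 0" using foil_eq[OF 1] w(2) u late by auto
      then show ?thesis using 1 by simp
    next
      case (2 k)
      then have "k = 0" using foil_eq[OF 2] w(3) u late by auto
      then show ?thesis using 2 by simp
    qed
    then show "u \<in> foil V F w" using u by (simp add: foil_def component_def)
  qed
  then have "finite ?S" using w(2) finite_subset by blast
  moreover have "infinite ?S"
    using w x(2) C by (intro no_last_finite_foil) auto
  ultimately show False by contradiction
qed

text \<open>
  Two foils of one component that have no junior foil coincide, so a finite one would be a
  distinguished finite set.
\<close>

lemma ex_junior:
  assumes x: "x \<in> V" "infinite (component V F x)" and y: "y \<in> component V F x"
    and fin: "finite (foil V F y)"
  shows "\<exists>z\<in>V. coalesce F y (F z)"
proof (rule ccontr)
  assume none: "\<not> (\<exists>z\<in>V. coalesce F y (F z))"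
  have yV: "y \<in> V" and C: "component V F x = component V F y"
    using y component_eq by (auto simp: component_def)
  let ?S = "{u \<in> component V F y. finite (foil V F u) \<and> \<not> (\<exists>z\<in>V. coalesce F u (F z))}"
  \<comment> \<open>a foil that contains a proper iterate has a junior foil\<close>
  have early: "k = 0" if "coalesce F u ((F ^^ k) v)" "v \<in> V" "\<not> (\<exists>z\<in>V. coalesce F u (F z))" for u v k
  proof (rule ccontr)
    assume "k \<noteq> 0"
    then obtain i where "k = Suc i" by (cases k) auto
    then have "coalesce F u (F ((F ^^ i) v))" using that(1) by simp
    then show False using that(2,3) funpow_closed by blast
  qed
  have "?S \<subseteq> foil V F y"
  proof
    fix u assume u: "u \<in> ?S"
    then have uV: "u \<in> V" and "connected_by F y u" by (simp_all add: component_def)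
    from this(2) have "coalesce F y u"
    proof (cases rule: connected_by_cases)
      case (1 k)
      then have "k = 0" using early[OF 1 uV none] by simp
      then show ?thesis using 1 by simp
    next
      case (2 k)
      then have "k = 0" using early[OF coalesce_sym[OF 2] yV] u by blast
      then show ?thesis using 2 by simp
    qed
    then show "u \<in> foil V F y" using uV by (simp add: foil_def)
  qed
  then have "finite ?S" using fin finite_subset by blast
  moreover have "infinite ?S"
    using yV x(2) C fin none by (intro no_first_foil) auto
  ultimately show False by contradiction
qed

text \<open>
  Iterating the existence of junior foils gives points of a given finite foil with preimages of each
  order; compactness gives a point that has them all.
\<close>

lemma ex_ancient:
  assumes x: "x \<in> V" "infinite (component V F x)"
    and fin: "\<And>y. y \<in> component V F x \<Longrightarrow> finite (foil V F y)"
  shows "\<exists>y\<in>component V F x. ancient V F y"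
proof -
  have deep: "\<exists>u\<in>V. coalesce F y ((F ^^ n) u)" if "y \<in> component V F x" for y n
    using that
  proof (induction n arbitrary: y)
    case 0
    then show ?case
      by (intro bexI[of _ y]) (auto simp: coalesce_refl component_def)
  next
    case (Suc n)
    obtain z where z: "z \<in> V" "coalesce F y (F z)"
      using ex_junior[OF x Suc.prems fin[OF Suc.prems]] by blast
    have "connected_by F x y"
      using Suc.prems by (simp add: component_def)
    also note coalesce_imp_connected_by[OF z(2)]
    also have "connected_by F (F z) z"
      using connected_by_sym[OF connected_by_funpow[of F z 1]] by simp
    finally have "connected_by F x z" .
    then obtain u where "u \<in> V" "coalesce F z ((F ^^ n) u)"
      using Suc.IH[of z] z(1) by (auto simp: component_def)
    then have "coalesce F y ((F ^^ Suc n) u)"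
      using coalesce_trans[OF z(2) coalesce_step] by simp
    with \<open>u \<in> V\<close> show ?case by blast
  qed
  have "\<exists>y\<in>foil V F x. \<forall>n. \<exists>z\<in>V. (F ^^ n) z = y"
  proof (rule finite_decreasing_witness[OF fin[OF component_self[OF x(1)]]])
    fix n
    show "\<exists>y\<in>foil V F x. \<exists>z\<in>V. (F ^^ n) z = y"
      using deep[OF component_self[OF x(1)], of n] funpow_closed by (auto simp: foil_def)
  next
    fix n y assume "\<exists>z\<in>V. (F ^^ Suc n) z = y"
    then obtain z where "z \<in> V" "(F ^^ n) (F z) = y" by (auto simp: funpow_swap1)
    then show "\<exists>z\<in>V. (F ^^ n) z = y" using closed by blast
  qed
  then show ?thesis
    using foil_subset_component unfolding ancient_def by blast
qed

text \<open>
  On the ancient points \<open>F\<close> is a bijection, so that it can be iterated backwards.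
\<close>

lemma bi_infinite_orbit:
  assumes y: "ancient V F y"
  shows "\<exists>x :: int \<Rightarrow> 'a. (\<forall>n. x n \<in> V) \<and> (\<forall>n. F (x n) = x (n + 1)) \<and> x 0 = y"
proof -
  let ?A = "{y \<in> V. ancient V F y}"
  let ?G = "inv_into ?A F"
  define x where "x n = (if 0 \<le> n then (F ^^ nat n) y else (?G ^^ nat (- n)) y)" for n :: int
  have yA: "y \<in> ?A" using y ancient_in by blast
  have G: "?G a \<in> ?A \<and> F (?G a) = a" if "a \<in> ?A" for a
  proof -
    have "a \<in> F ` ?A" using that image_ancient[OF finite_fibres] by simp
    from inv_into_into[OF this] f_inv_into_f[OF this] show ?thesis ..
  qed
  have Gn: "(?G ^^ n) y \<in> ?A" for n
    by (induction n) (use yA G in auto)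
  have "x n \<in> V" for n
    using Gn funpow_closed[OF ancient_in[OF y]] by (auto simp: x_def)
  moreover have "F (x n) = x (n + 1)" for n
  proof (cases "0 \<le> n")
    case True
    then have "nat (n + 1) = Suc (nat n)" by simp
    with True show ?thesis by (simp add: x_def)
  next
    case False
    then have s: "nat (- n) = Suc (nat (- (n + 1)))" by simp
    have "F (x n) = (?G ^^ nat (- (n + 1))) y"
      using False G[OF Gn] by (simp add: x_def s del: nat_minus_as_int)
    also have "\<dots> = x (n + 1)"
    proof (cases "n = -1")
      case True then show ?thesis by (simp add: x_def)
    next
      case n: False
      then show ?thesis using False by (simp add: x_def)
    qed
    finally show ?thesis .
  qed
  ultimately show ?thesis by (intro exI[of _ x]) (simp add: x_def)
qed

end

lemma orbit_funpow:
  fixes x :: "int \<Rightarrow> 'a"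
  assumes "\<And>n. F (x n) = x (n + 1)"
  shows "(F ^^ k) (x n) = x (n + int k)"
  by (induction k) (auto simp: assms algebra_simps)

context regular_map
begin

lemma orbit_ancient:
  fixes x :: "int \<Rightarrow> 'a"
  assumes "\<And>n. x n \<in> V" "\<And>n. F (x n) = x (n + 1)"
  shows "ancient V F (x n)"
  unfolding ancient_def
proof
  fix k
  have "(F ^^ k) (x (n - int k)) = x n" by (simp add: orbit_funpow[of F x, OF assms(2)])
  then show "\<exists>z\<in>V. (F ^^ k) z = x n" using assms(1) by blast
qed

text \<open>
  An ancient point of the component meets the orbit of \<open>x 0\<close> after finitely many steps,
  and by injectivity on ancient points it was on the orbit all along.
\<close>

lemma orbit_range:
  fixes x :: "int \<Rightarrow> 'a"
  assumes x: "\<And>n. x n \<in> V" "\<And>n. F (x n) = x (n + 1)"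
  shows "range x = {y \<in> component V F (x 0). ancient V F y}"
proof (intro equalityI subsetI)
  note pow = orbit_funpow[of F x, OF x(2)]
  fix y assume "y \<in> range x"
  then obtain n where n: "y = x n" by blast
  have "connected_by F (x 0) (x n)"
  proof (cases "0 \<le> n")
    case True
    then have "(F ^^ nat n) (x 0) = (F ^^ 0) (x n)" by (simp add: pow)
    then show ?thesis unfolding connected_by_def by blast
  next
    case False
    then have "(F ^^ 0) (x 0) = (F ^^ nat (- n)) (x n)" by (simp add: pow)
    then show ?thesis unfolding connected_by_def by blast
  qed
  then show "y \<in> {y \<in> component V F (x 0). ancient V F y}"
    using x orbit_ancient[of x, OF x] by (simp add: n component_def)
next
  note pow = orbit_funpow[of F x, OF x(2)]
  fix y assume "y \<in> {y \<in> component V F (x 0). ancient V F y}"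
  then have y: "ancient V F y" and "connected_by F (x 0) y" by (auto simp: component_def)
  then obtain a b where ab: "(F ^^ a) (x 0) = (F ^^ b) y" unfolding connected_by_def by blast
  have "(F ^^ b) (x (int a - int b)) = (F ^^ b) y" using ab by (simp add: pow)
  then have "x (int a - int b) = y"
    using inj_funpow_ancient[OF orbit_ancient[of x, OF x] y] by blast
  then show "y \<in> range x" by blast
qed

lemma orbit_unique:
  fixes x z :: "int \<Rightarrow> 'a"
  assumes x: "\<And>n. x n \<in> V" "\<And>n. F (x n) = x (n + 1)" and z: "\<And>n. z n \<in> V" "\<And>n. F (z n) = z (n + 1)"
    and "range z \<subseteq> component V F (x 0)"
  shows "\<exists>k. \<forall>n. z n = x (n + k)"
proof -
  have "z 0 \<in> range x"
    using assms(5) orbit_ancient[of z, OF z] by (auto simp: orbit_range[of x, OF x])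
  then obtain k where k: "z 0 = x k" by blast
  have "z n = x (n + k)" for n
  proof (cases "0 \<le> n")
    case True
    then show ?thesis
      using orbit_funpow[of F x "nat n" k, OF x(2)] orbit_funpow[of F z "nat n" 0, OF z(2)] k
      by (simp add: add.commute)
  next
    case False
    then have "(F ^^ nat (- n)) (z n) = (F ^^ nat (- n)) (x (n + k))"
      using orbit_funpow[of F x "nat (- n)" "n + k", OF x(2)] orbit_funpow[of F z "nat (- n)" n, OF z(2)] k
      by simp
    then show ?thesis
      using inj_funpow_ancient orbit_ancient[of z, OF z] orbit_ancient[of x, OF x] by blast
  qed
  then show ?thesis by blast
qed

lemma finite_component_cycle:
  assumes x: "x \<in> V" "finite (component V F x)"
  shows "\<exists>c\<in>component V F x. \<exists>p>0. (F ^^ p) c = c \<and> inj_on (\<lambda>k. (F ^^ k) c) {..<p}"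
proof -
  have "(\<lambda>k. (F ^^ k) x) ` UNIV \<subseteq> component V F x"
    using x funpow_closed connected_by_funpow by (auto simp: component_def)
  then have "\<not> inj (\<lambda>k. (F ^^ k) x)"
    using x(2) finite_subset infinite_UNIV_nat finite_imageD by metis
  then obtain i j where ij: "i < j" "(F ^^ i) x = (F ^^ j) x"
    unfolding inj_def by (metis linorder_neqE_nat)
  define c where "c = (F ^^ i) x"
  have cC: "c \<in> component V F x"
    using x funpow_closed connected_by_funpow by (auto simp: component_def c_def)
  have "(F ^^ (j - i)) c = (F ^^ (j - i + i)) x"
    by (simp only: c_def funpow_plus)
  also have "\<dots> = c"
    using ij by (simp add: c_def)
  finally have "(F ^^ (j - i)) c = c" .
  then have "\<exists>p. 0 < p \<and> (F ^^ p) c = c" using ij(1) by (intro exI[of _ "j - i"]) simp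
  then obtain p where p: "0 < p \<and> (F ^^ p) c = c" and min: "\<forall>q<p. \<not> (0 < q \<and> (F ^^ q) c = c)"
    using exists_least_iff[of "\<lambda>p. 0 < p \<and> (F ^^ p) c = c"] by blast
  have ne: "(F ^^ a) c \<noteq> (F ^^ b) c" if "a < b" "b < p" for a b
  proof
    assume "(F ^^ a) c = (F ^^ b) c"
    then have "(F ^^ (p - b)) ((F ^^ a) c) = (F ^^ (p - b)) ((F ^^ b) c)" by simp
    then have "(F ^^ (p - b + a)) c = c" using that p by (simp add: funpow_plus)
    moreover have "p - b + a < p" "0 < p - b + a" using that by auto
    ultimately show False using min by blast
  qed
  have "inj_on (\<lambda>k. (F ^^ k) c) {..<p}"
  proof (rule inj_onI)
    fix a b assume "a \<in> {..<p}" "b \<in> {..<p}" "(F ^^ a) c = (F ^^ b) c"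
    then show "a = b" using ne[of a b] ne[of b a] by (cases a b rule: linorder_cases) auto
  qed
  with cC p show ?thesis by blast
qed

text \<open>
  A point whose orbit enters the cycle at a given phase coalesces with the cyclic point of the same
  phase, so each foil of the component contains a point of the cycle.
\<close>

lemma coalesce_cycle:
  assumes c: "c \<in> V" "(F ^^ p) c = c" "0 < p" and "connected_by F c y"
  shows "\<exists>k<p. coalesce F y ((F ^^ k) c)"
proof -
  have "\<exists>k. coalesce F y ((F ^^ k) c)"
    using assms(4)
  proof (cases rule: connected_by_cases)
    case (2 k)
    from coalesce_sym[OF 2] show ?thesis by blast
  next
    case (1 k)
    then obtain n where "(F ^^ n) c = (F ^^ n) ((F ^^ k) y)"
      unfolding coalesce_def by (rule exE)
    then have n: "(F ^^ n) c = (F ^^ (n + k)) y"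
      by (simp only: funpow_plus)
    have "(F ^^ (n + k)) ((F ^^ (k * p - k)) c) = (F ^^ (n + k * p)) c"
      using c(3) by (simp add: funpow_plus)
    also have "\<dots> = (F ^^ n) ((F ^^ (k * p)) c)"
      by (simp add: funpow_plus)
    also have "(F ^^ (k * p)) c = c"
      using funpow_mod_eq[OF c(2), of "k * p"] by simp
    finally have "(F ^^ (n + k)) y = (F ^^ (n + k)) ((F ^^ (k * p - k)) c)"
      by (simp only: n)
    then show ?thesis unfolding coalesce_def by blast
  qed
  then obtain k where "coalesce F y ((F ^^ k) c)" by blast
  then have "coalesce F y ((F ^^ (k mod p)) c)"
    by (simp add: funpow_mod_eq[OF c(2)])
  then show ?thesis using c(3) by (intro exI[of _ "k mod p"]) simp
qed

text \<open>
  Cyclic points are ancient, and distinct ancient points lie in distinct foils.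
\<close>

lemma bij_cycle_foils:
  assumes c: "c \<in> V" "(F ^^ p) c = c" "0 < p" and inj: "inj_on (\<lambda>k. (F ^^ k) c) {..<p}"
  shows "bij_betw (\<lambda>k. foil V F ((F ^^ k) c)) {..<p} (foil V F ` component V F c)"
proof (rule bij_betwI')
  have anc: "ancient V F ((F ^^ k) c)" for k
    using ancient_funpow ancient_cyclic[OF c] by blast
  show "foil V F ((F ^^ i) c) = foil V F ((F ^^ j) c) \<longleftrightarrow> i = j" if "i \<in> {..<p}" "j \<in> {..<p}" for i j
  proof
    assume "foil V F ((F ^^ i) c) = foil V F ((F ^^ j) c)"
    then have "(F ^^ j) c \<in> foil V F ((F ^^ i) c)"
      using foil_self[OF funpow_closed[OF c(1)], of j] by simp
    then have "(F ^^ i) c = (F ^^ j) c"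
      using coalesce_ancient_eq[OF anc anc] by (simp add: foil_def)
    then show "i = j" using inj_onD[OF inj] that by blast
  qed simp
  show "foil V F ((F ^^ k) c) \<in> foil V F ` component V F c" for k
    by (intro imageI) (simp add: component_def funpow_closed[OF c(1)] connected_by_funpow)
  show "\<exists>k\<in>{..<p}. L = foil V F ((F ^^ k) c)" if L: "L \<in> foil V F ` component V F c" for L
  proof -
    obtain y where "L = foil V F y" "connected_by F c y" using L by (auto simp: component_def)
    moreover obtain k where "k < p" "coalesce F y ((F ^^ k) c)"
      using coalesce_cycle[OF c calculation(2)] by blast
    ultimately have "L = foil V F ((F ^^ k) c)" "k \<in> {..<p}"
      using foil_eq[of y "(F ^^ k) c"] by simp_all
    then show ?thesis by blast
  qed
qed

lemma ancient_of_finite_component: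
  assumes c: "c \<in> V" "(F ^^ p) c = c" "0 < p"
  shows "{y \<in> component V F c. ancient V F y} = (\<lambda>k. (F ^^ k) c) ` {..<p}"
proof (intro equalityI subsetI)
  have anc: "ancient V F ((F ^^ k) c)" for k
    using ancient_funpow ancient_cyclic[OF c] by blast
  fix y assume "y \<in> {y \<in> component V F c. ancient V F y}"
  then have y: "connected_by F c y" "ancient V F y" by (simp_all add: component_def)
  then obtain k where "k < p" "coalesce F y ((F ^^ k) c)"
    using coalesce_cycle[OF c] by blast
  then show "y \<in> (\<lambda>k. (F ^^ k) c) ` {..<p}"
    using coalesce_ancient_eq[OF y(2) anc] by (intro image_eqI[of _ _ k]) simp_all
next
  have anc: "ancient V F ((F ^^ k) c)" for k
    using ancient_funpow ancient_cyclic[OF c] by blast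
  fix y assume "y \<in> (\<lambda>k. (F ^^ k) c) ` {..<p}"
  then show "y \<in> {y \<in> component V F c. ancient V F y}"
    using anc funpow_closed[OF c(1)] connected_by_funpow by (auto simp: component_def)
qed

end

section \<open>Cycles of the graph\<close>

text \<open>
  In the graph of a map a walk is determined by its first vertex and its length.
\<close>

definition orbit_arcs :: "('a \<Rightarrow> 'a) \<Rightarrow> 'a \<Rightarrow> nat \<Rightarrow> ('a \<times> 'a) list" where
  "orbit_arcs F u n = map (\<lambda>k. ((F ^^ k) u, (F ^^ Suc k) u)) [0..<n]"

lemma length_orbit_arcs [simp]: "length (orbit_arcs F u n) = n"
  by (simp add: orbit_arcs_def)

lemma orbit_arcs_Suc: "orbit_arcs F u (Suc n) = (u, F u) # orbit_arcs F (F u) n"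
  unfolding orbit_arcs_def map_upt_Suc by (simp add: funpow_swap1)

lemma cas_orbit_arcs:
  assumes G: "tail G = fst" "head G = snd" and "set q \<subseteq> {(x, F x) | x. True}"
  shows "pre_digraph.cas G u q v \<longleftrightarrow> q = orbit_arcs F u (length q) \<and> v = (F ^^ length q) u"
  using assms(3)
proof (induction q arbitrary: u)
  case Nil
  then show ?case by (auto simp: pre_digraph.cas.simps orbit_arcs_def)
next
  case (Cons e es)
  then obtain a where e: "e = (a, F a)" by auto
  show ?case
    using Cons.IH[of "F a"] Cons.prems
    by (auto simp: pre_digraph.cas.simps orbit_arcs_Suc e G funpow_swap1)
qed

text \<open>
  For a closed walk the vertices after the first one, which the library requires to be distinct, are
  the same as those before the last one.
\<close>

lemma is_cycle_of_iff:
  fixes f :: "'a::euclidean_space set \<Rightarrow> 'a"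
  defines "F \<equiv> \<lambda>\<phi>. point_shift f \<phi>"
  assumes C: "C \<subseteq> \<phi>" and cl: "\<And>x. x \<in> C \<Longrightarrow> F \<phi> x \<in> C"
  shows "is_cycle_of f \<phi> C q \<longleftrightarrow> (\<exists>u\<in>C. \<exists>n>0. q = orbit_arcs (F \<phi>) u n \<and> (F \<phi> ^^ n) u = u \<and>
    inj_on (\<lambda>k. (F \<phi> ^^ k) u) {..<n})"
proof -
  define G where "G = shift_graph f \<phi> \<restriction> C"
  have G: "tail G = fst" "head G = snd" "verts G = C" "arcs G = {(x, F \<phi> x) | x. x \<in> C}"
    using C cl by (auto simp: G_def shift_graph_def F_def induce_subgraph_def)
  have cl': "(F \<phi> ^^ k) u \<in> C" if "u \<in> C" for u k
    using that by (induction k) (auto intro: cl)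
  have walk: "pre_digraph.awalk G u q u \<longleftrightarrow> u \<in> C \<and> q = orbit_arcs (F \<phi>) u (length q) \<and> (F \<phi> ^^ length q) u = u"
    for u
  proof
    assume w: "pre_digraph.awalk G u q u"
    then have "pre_digraph.cas G u q u" "u \<in> C" "set q \<subseteq> {(x, F \<phi> x) | x. True}"
      by (auto simp: pre_digraph.awalk_def G)
    then show "u \<in> C \<and> q = orbit_arcs (F \<phi>) u (length q) \<and> (F \<phi> ^^ length q) u = u"
      using cas_orbit_arcs[OF G(1,2), of q "F \<phi>" u u] by simp
  next
    assume *: "u \<in> C \<and> q = orbit_arcs (F \<phi>) u (length q) \<and> (F \<phi> ^^ length q) u = u"
    then have "set q = set (orbit_arcs (F \<phi>) u (length q))" by simp
    then have q: "set q \<subseteq> {(x, F \<phi> x) | x. x \<in> C}"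
      using cl' * by (auto simp: orbit_arcs_def)
    then have "set q \<subseteq> {(x, F \<phi> x) | x. True}" by blast
    then have "pre_digraph.cas G u q u"
      using cas_orbit_arcs[OF G(1,2), of q "F \<phi>" u u] * by simp
    with * q show "pre_digraph.awalk G u q u" by (simp add: pre_digraph.awalk_def G)
  qed
  have verts: "distinct (tl (pre_digraph.awalk_verts G u q)) \<longleftrightarrow> inj_on (\<lambda>k. (F \<phi> ^^ k) u) {..<length q}"
    if w: "pre_digraph.awalk G u q u" and ne: "q \<noteq> []" for u
  proof -
    let ?h = "\<lambda>k. (F \<phi> ^^ k) u" and ?n = "length q"
    have q: "q = orbit_arcs (F \<phi>) u ?n" "?h ?n = u" using w walk by blast+
    obtain m where m: "?n = Suc m" using ne by (cases q) auto
    have "pre_digraph.awalk_verts G u q = tail G (hd q) # map (head G) q"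
      using pre_digraph.awalk_verts_conv'[of G u q u] w ne by (simp add: pre_digraph.awalk_def)
    then have "tl (pre_digraph.awalk_verts G u q) = map snd (orbit_arcs (F \<phi>) u ?n)"
      using q(1) by (simp add: G)
    also have "\<dots> = map (\<lambda>k. ?h (Suc k)) [0..<?n]"
      by (simp add: orbit_arcs_def)
    finally have "distinct (tl (pre_digraph.awalk_verts G u q)) \<longleftrightarrow> inj_on (\<lambda>k. ?h (Suc k)) {..<?n}"
      by (simp add: distinct_map atLeast0LessThan)
    also have "\<dots> \<longleftrightarrow> card ((\<lambda>k. ?h (Suc k)) ` {..<?n}) = ?n"
      by (simp add: inj_on_iff_eq_card)
    also have "(\<lambda>k. ?h (Suc k)) ` {..<?n} = ?h ` {..<?n}"
    proof -
      have "(\<lambda>k. ?h (Suc k)) ` {..<?n} = ?h ` Suc ` {..<?n}" by (simp only: image_image)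
      also have "\<dots> = ?h ` {..<?n}"
      proof (intro equalityI subsetI)
        fix y assume "y \<in> ?h ` Suc ` {..<?n}"
        then obtain k where k: "k < ?n" "y = ?h (Suc k)" by blast
        show "y \<in> ?h ` {..<?n}"
        proof (cases "Suc k = ?n")
          case True
          then have "y = ?h 0" using k q(2) by simp
          moreover have "0 < ?n" using m by simp
          ultimately show ?thesis by blast
        next
          case False
          then have "Suc k < ?n" using k by simp
          then show ?thesis using k by blast
        qed
      next
        fix y assume "y \<in> ?h ` {..<?n}"
        then obtain k where k: "k < ?n" "y = ?h k" by blast
        show "y \<in> ?h ` Suc ` {..<?n}"
        proof (cases k)
          case 0
          then have "y = ?h (Suc m)" using k q(2) m by simp
          moreover have "m < ?n" using m by simp
          ultimately show ?thesis by blast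
        next
          case (Suc i)
          then have "i < ?n" "y = ?h (Suc i)" using k by auto
          then show ?thesis by blast
        qed
      qed
      finally show ?thesis .
    qed
    also have "card (?h ` {..<?n}) = ?n \<longleftrightarrow> inj_on ?h {..<?n}"
      by (simp add: inj_on_iff_eq_card)
    finally show ?thesis .
  qed
  have "is_cycle_of f \<phi> C q \<longleftrightarrow> (\<exists>u. pre_digraph.awalk G u q u \<and>
      distinct (tl (pre_digraph.awalk_verts G u q)) \<and> q \<noteq> [])"
    by (simp add: is_cycle_of_def pre_digraph.cycle_def G_def)
  also have "\<dots> \<longleftrightarrow> (\<exists>u. pre_digraph.awalk G u q u \<and> inj_on (\<lambda>k. (F \<phi> ^^ k) u) {..<length q} \<and> q \<noteq> [])"
    using verts by blast
  also have "\<dots> \<longleftrightarrow> (\<exists>u\<in>C. \<exists>n>0. q = orbit_arcs (F \<phi>) u n \<and> (F \<phi> ^^ n) u = u \<and>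
    inj_on (\<lambda>k. (F \<phi> ^^ k) u) {..<n})"
  proof
    assume "\<exists>u. pre_digraph.awalk G u q u \<and> inj_on (\<lambda>k. (F \<phi> ^^ k) u) {..<length q} \<and> q \<noteq> []"
    then obtain u where "u \<in> C" "q = orbit_arcs (F \<phi>) u (length q)" "(F \<phi> ^^ length q) u = u"
      "inj_on (\<lambda>k. (F \<phi> ^^ k) u) {..<length q}" "0 < length q" using walk by blast
    then show "\<exists>u\<in>C. \<exists>n>0. q = orbit_arcs (F \<phi>) u n \<and> (F \<phi> ^^ n) u = u \<and>
      inj_on (\<lambda>k. (F \<phi> ^^ k) u) {..<n}" by blast
  next
    assume "\<exists>u\<in>C. \<exists>n>0. q = orbit_arcs (F \<phi>) u n \<and> (F \<phi> ^^ n) u = u \<and>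
      inj_on (\<lambda>k. (F \<phi> ^^ k) u) {..<n}"
    then obtain u n where "u \<in> C" "0 < n" "q = orbit_arcs (F \<phi>) u n" "(F \<phi> ^^ n) u = u"
      "inj_on (\<lambda>k. (F \<phi> ^^ k) u) {..<n}" by blast
    moreover from this have "length q = n" by simp
    moreover have "q \<noteq> []" using calculation by force
    ultimately have "pre_digraph.awalk G u q u \<and> inj_on (\<lambda>k. (F \<phi> ^^ k) u) {..<length q} \<and> q \<noteq> []"
      using walk[of u] by simp
    then show "\<exists>u. pre_digraph.awalk G u q u \<and> inj_on (\<lambda>k. (F \<phi> ^^ k) u) {..<length q} \<and> q \<noteq> []"
      by blast
  qed
  finally show ?thesis .
qed

lemma orbit_arcs_rotate:
  assumes c: "(F ^^ p) c = c"
  shows "orbit_arcs F ((F ^^ j) c) p = rotate j (orbit_arcs F c p)"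
proof (rule nth_equalityI)
  fix i assume "i < length (orbit_arcs F ((F ^^ j) c) p)"
  then have i: "i < p" by simp
  then have m: "(j + i) mod p < p" by simp
  have "(F ^^ ((j + i) mod p)) c = (F ^^ (j + i)) c"
    by (rule funpow_mod_eq[OF c])
  also have "\<dots> = (F ^^ i) ((F ^^ j) c)"
    by (simp only: funpow_plus add.commute)
  finally have "(F ^^ ((j + i) mod p)) c = (F ^^ i) ((F ^^ j) c)" .
  then show "orbit_arcs F ((F ^^ j) c) p ! i = rotate j (orbit_arcs F c p) ! i"
    using i m by (simp add: nth_rotate orbit_arcs_def)
qed simp

section \<open>Components of a regular configuration\<close>

lemma shift_components_eq:
  "shift_components f \<phi> = component \<phi> (point_shift f \<phi>) ` \<phi>"
  by (auto simp: shift_components_def quotient_def component_rel_def component_def connected_by_def)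

lemma foils_of_eq:
  assumes "self_map \<phi> (point_shift f \<phi>)" "x \<in> \<phi>"
  shows "foils_of f \<phi> (component \<phi> (point_shift f \<phi>) x) =
    foil \<phi> (point_shift f \<phi>) ` component \<phi> (point_shift f \<phi>) x"
proof -
  interpret self_map \<phi> "point_shift f \<phi>" by fact
  let ?F = "point_shift f \<phi>"
  have quot: "\<phi> // foil_rel f \<phi> = foil \<phi> ?F ` \<phi>"
    by (auto simp: quotient_def foil_rel_def foil_def coalesce_def)
  have "foil \<phi> ?F y \<subseteq> component \<phi> ?F x \<longleftrightarrow> y \<in> component \<phi> ?F x" if "y \<in> \<phi>" for y
  proof
    assume "foil \<phi> ?F y \<subseteq> component \<phi> ?F x"
    then show "y \<in> component \<phi> ?F x" using foil_self[OF that] by blast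
  next
    assume "y \<in> component \<phi> ?F x"
    then have "component \<phi> ?F x = component \<phi> ?F y" by (intro component_eq) (simp add: component_def)
    then show "foil \<phi> ?F y \<subseteq> component \<phi> ?F x" using foil_subset_component[of y] by simp
  qed
  then show ?thesis
    unfolding foils_of_def quot using component_subset by blast
qed

lemma F_infinity_eq:
  assumes "self_map \<phi> (point_shift f \<phi>)" "x \<in> \<phi>"
  shows "F_infinity f \<phi> (component \<phi> (point_shift f \<phi>) x) =
    {y \<in> component \<phi> (point_shift f \<phi>) x. ancient \<phi> (point_shift f \<phi>) y}"
proof -
  interpret self_map \<phi> "point_shift f \<phi>" by fact
  let ?F = "point_shift f \<phi>"
  show ?thesis
  proof (intro equalityI subsetI)
    fix y assume "y \<in> F_infinity f \<phi> (component \<phi> ?F x)"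
    then have y: "y \<in> (?F ^^ n) ` component \<phi> ?F x" for n by (simp add: F_infinity_def)
    have "\<exists>z\<in>\<phi>. (?F ^^ n) z = y" for n
      using y[of n] by (auto simp: component_def)
    then show "y \<in> {y \<in> component \<phi> ?F x. ancient \<phi> ?F y}"
      using y[of 0] by (simp add: ancient_def)
  next
    fix y assume y: "y \<in> {y \<in> component \<phi> ?F x. ancient \<phi> ?F y}"
    have "y \<in> (?F ^^ n) ` component \<phi> ?F x" for n
    proof -
      obtain z where z: "z \<in> \<phi>" "(?F ^^ n) z = y" using y unfolding ancient_def by blast
      have "connected_by ?F x y" using y by (simp add: component_def)
      also have "connected_by ?F y z" using connected_by_sym[OF connected_by_funpow[of ?F z n]] z(2) by simp
      finally show ?thesis using z by (auto simp: component_def)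
    qed
    then show "y \<in> F_infinity f \<phi> (component \<phi> ?F x)" by (simp add: F_infinity_def)
  qed
qed

lemma regular_finite_component:
  fixes f :: "'a::euclidean_space set \<Rightarrow> 'a"
  defines "F \<equiv> \<lambda>\<phi>. point_shift f \<phi>"
  assumes reg: "regular_map \<phi> (F \<phi>)" and x: "x \<in> \<phi>"
    and C: "C = component \<phi> (F \<phi>) x" and fin: "finite C"
  shows "\<exists>p. is_cycle_of f \<phi> C p \<and> (\<forall>q. is_cycle_of f \<phi> C q \<longrightarrow> (\<exists>k. q = rotate k p)) \<and>
      length p = card (foils_of f \<phi> C) \<and> F_infinity f \<phi> C = tail (shift_graph f \<phi>) ` set p"
proof -
  interpret regular_map \<phi> "F \<phi>" by fact
  have sm: "self_map \<phi> (point_shift f \<phi>)" using self_map_axioms by (simp add: F_def)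
  obtain c p where c: "c \<in> C" "0 < p" "(F \<phi> ^^ p) c = c" and inj: "inj_on (\<lambda>k. (F \<phi> ^^ k) c) {..<p}"
    using finite_component_cycle[OF x] fin unfolding C by blast
  have cV: "c \<in> \<phi>" and "connected_by (F \<phi>) x c" using c(1) by (auto simp: C component_def)
  then have Cc: "C = component \<phi> (F \<phi>) c" unfolding C by (intro component_eq)
  have CV: "C \<subseteq> \<phi>" by (auto simp: C component_def)
  have cl: "F \<phi> y \<in> C" if "y \<in> C" for y
    using that component_step by (simp add: C)
  note cycle_iff = is_cycle_of_iff[OF CV, of f, folded F_def, OF cl]
  let ?p = "orbit_arcs (F \<phi>) c p"
  have "is_cycle_of f \<phi> C ?p"
    using cycle_iff c inj by blast
  moreover have "\<exists>k. q = rotate k ?p" if q: "is_cycle_of f \<phi> C q" for q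
  proof -
    obtain u n where u: "u \<in> C" "0 < n" "q = orbit_arcs (F \<phi>) u n" "(F \<phi> ^^ n) u = u"
      "inj_on (\<lambda>k. (F \<phi> ^^ k) u) {..<n}"
      using cycle_iff q by blast
    have "connected_by (F \<phi>) c u" using u(1) by (simp add: Cc component_def)
    then obtain j where j: "j < p" "u = (F \<phi> ^^ j) c"
      using cycle_index[OF c(3,2) u(4,2)] by blast
    \<comment> \<open>both cycles have the same minimal period\<close>
    have "\<not> n < p"
    proof
      assume "n < p"
      have "(F \<phi> ^^ n) c = (F \<phi> ^^ n) ((F \<phi> ^^ (p - j)) u)"
        using j c(3) by (simp add: funpow_plus)
      also have "\<dots> = (F \<phi> ^^ (p - j)) ((F \<phi> ^^ n) u)"
        by (simp only: funpow_plus add.commute)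
      also have "\<dots> = (F \<phi> ^^ 0) c"
        using j c(3) u(4) by (simp add: funpow_plus)
      finally have "n = 0"
        using inj_onD[OF inj, of n 0] \<open>n < p\<close> c(2) by simp
      then show False using u(2) by simp
    qed
    moreover have "\<not> p < n"
    proof
      assume "p < n"
      have "(F \<phi> ^^ p) u = (F \<phi> ^^ j) ((F \<phi> ^^ p) c)"
        by (simp only: j(2) funpow_plus add.commute)
      also have "\<dots> = (F \<phi> ^^ 0) u"
        by (simp add: c(3) j(2))
      finally have "p = 0"
        using inj_onD[OF u(5), of p 0] \<open>p < n\<close> u(2) by simp
      then show False using c(2) by simp
    qed
    ultimately have "n = p" by simp
    then show ?thesis
      using orbit_arcs_rotate[OF c(3), of j] u(3) j(2) by blast
  qed
  moreover have "length ?p = card (foils_of f \<phi> C)"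
    using bij_betw_same_card[OF bij_cycle_foils[OF cV c(3,2) inj]] foils_of_eq[OF sm x]
    by (simp add: Cc C[symmetric] flip: F_def)
  moreover have "F_infinity f \<phi> C = tail (shift_graph f \<phi>) ` set ?p"
  proof -
    have "F_infinity f \<phi> C = {y \<in> C. ancient \<phi> (F \<phi>) y}"
      using F_infinity_eq[OF sm x] by (simp add: C F_def)
    also have "\<dots> = (\<lambda>k. (F \<phi> ^^ k) c) ` {..<p}"
      using ancient_of_finite_component[OF cV c(3,2)] by (simp add: Cc)
    also have "\<dots> = tail (shift_graph f \<phi>) ` set ?p"
      by (simp add: shift_graph_def orbit_arcs_def image_image atLeast0LessThan)
    finally show ?thesis .
  qed
  ultimately show ?thesis by blast
qed

lemma regular_infinite_component_acyclic:
  fixes f :: "'a::euclidean_space set \<Rightarrow> 'a"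
  assumes reg: "regular_map \<phi> (point_shift f \<phi>)" and x: "x \<in> \<phi>"
    and C: "C = component \<phi> (point_shift f \<phi>) x" and inf: "infinite C"
  shows "acyclic_component f \<phi> C"
proof -
  let ?F = "point_shift f \<phi>"
  interpret regular_map \<phi> ?F by fact
  have CV: "C \<subseteq> \<phi>" by (auto simp: C component_def)
  have cl: "?F y \<in> C" if "y \<in> C" for y
    using that component_step by (simp add: C)
  have "\<not> is_cycle_of f \<phi> C q" for q
  proof
    assume "is_cycle_of f \<phi> C q"
    then obtain u n where "u \<in> C" "0 < n" "(?F ^^ n) u = u"
      using is_cycle_of_iff[OF CV cl] by blast
    then show False
      using infinite_component_acyclic[OF x inf[unfolded C]] by (simp add: C)
  qed
  then show ?thesis by (simp add: acyclic_component_def)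
qed

lemma regular_classification:
  fixes f :: "'a::euclidean_space set \<Rightarrow> 'a"
  assumes reg: "regular_map \<phi> (point_shift f \<phi>)" and C: "C \<in> shift_components f \<phi>"
  shows "(class_FF f \<phi> C \<or> class_IF f \<phi> C \<or> class_II f \<phi> C) \<and>
    (class_FF f \<phi> C \<longrightarrow>
       (\<forall>L \<in> foils_of f \<phi> C. finite L) \<and>
       finite (foils_of f \<phi> C) \<and> 1 \<le> card (foils_of f \<phi> C) \<and>
       (\<exists>p. is_cycle_of f \<phi> C p \<and>
            (\<forall>q. is_cycle_of f \<phi> C q \<longrightarrow> (\<exists>k. q = rotate k p)) \<and>
            length p = card (foils_of f \<phi> C) \<and>
            F_infinity f \<phi> C = tail (shift_graph f \<phi>) ` set p)) \<and>
    (class_IF f \<phi> C \<longrightarrow>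
       acyclic_component f \<phi> C \<and>
       (\<forall>L \<in> foils_of f \<phi> C. \<exists>L' \<in> foils_of f \<phi> C.
          \<forall>y \<in> L'. point_shift f \<phi> y \<in> L) \<and>
       (\<exists>x. bi_infinite_path f \<phi> x \<and> F_infinity f \<phi> C = range x \<and>
            (\<forall>z. bi_infinite_path f \<phi> z \<and> range z \<subseteq> C \<longrightarrow>
               (\<exists>k. \<forall>n. z n = x (n + k))))) \<and>
    (class_II f \<phi> C \<longrightarrow>
       acyclic_component f \<phi> C \<and>
       F_infinity f \<phi> C = {})"
proof -
  let ?F = "point_shift f \<phi>"
  interpret regular_map \<phi> ?F by fact
  obtain x where x: "x \<in> \<phi>" and Cx: "C = component \<phi> ?F x"
    using C by (auto simp: shift_components_eq)
  have foils: "foils_of f \<phi> C = foil \<phi> ?F ` C"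
    unfolding Cx by (rule foils_of_eq[OF self_map_axioms x])
  have Finf: "F_infinity f \<phi> C = {y \<in> C. ancient \<phi> ?F y}"
    unfolding Cx by (rule F_infinity_eq[OF self_map_axioms x])
  have xC: "x \<in> C" unfolding Cx by (rule component_self[OF x])
  have sub: "foil \<phi> ?F y \<subseteq> C" if "y \<in> C" for y
  proof -
    have "component \<phi> ?F x = component \<phi> ?F y"
      using that by (intro component_eq) (simp add: Cx component_def)
    then show ?thesis using foil_subset_component[of y] by (simp add: Cx)
  qed
  have trichotomy: "class_FF f \<phi> C \<or> class_IF f \<phi> C \<or> class_II f \<phi> C"
  proof (cases "finite C \<or> (\<forall>y\<in>C. finite (foil \<phi> ?F y))")
    case False
    then obtain y where y: "y \<in> C" "infinite (foil \<phi> ?F y)" "infinite C" by blast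
    have "infinite (foil \<phi> ?F z)" if "z \<in> C" for z
      using foils_alike[OF x, of z y] y that by (auto simp: Cx)
    then show ?thesis using y(3) by (auto simp: class_II_def foils)
  qed (auto simp: class_FF_def class_IF_def foils)
  have FF: "(\<forall>L \<in> foils_of f \<phi> C. finite L) \<and>
       finite (foils_of f \<phi> C) \<and> 1 \<le> card (foils_of f \<phi> C) \<and>
       (\<exists>p. is_cycle_of f \<phi> C p \<and>
            (\<forall>q. is_cycle_of f \<phi> C q \<longrightarrow> (\<exists>k. q = rotate k p)) \<and>
            length p = card (foils_of f \<phi> C) \<and>
            F_infinity f \<phi> C = tail (shift_graph f \<phi>) ` set p)" if "class_FF f \<phi> C"
  proof (intro conjI)
    have fin: "finite C" using that by (simp add: class_FF_def)
    show "\<forall>L \<in> foils_of f \<phi> C. finite L"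
      unfolding foils using sub finite_subset[OF _ fin] by auto
    show fin_foils: "finite (foils_of f \<phi> C)"
      unfolding foils using fin by simp
    have "foils_of f \<phi> C \<noteq> {}" unfolding foils using xC by blast
    then have "0 < card (foils_of f \<phi> C)" using fin_foils by (simp add: card_gt_0_iff)
    then show "1 \<le> card (foils_of f \<phi> C)" by simp
    show "\<exists>p. is_cycle_of f \<phi> C p \<and>
            (\<forall>q. is_cycle_of f \<phi> C q \<longrightarrow> (\<exists>k. q = rotate k p)) \<and>
            length p = card (foils_of f \<phi> C) \<and>
            F_infinity f \<phi> C = tail (shift_graph f \<phi>) ` set p"
      by (rule regular_finite_component[OF reg x Cx fin])
  qed
  have IF: "acyclic_component f \<phi> C \<and>
       (\<forall>L \<in> foils_of f \<phi> C. \<exists>L' \<in> foils_of f \<phi> C. \<forall>y \<in> L'. ?F y \<in> L) \<and>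
       (\<exists>x. bi_infinite_path f \<phi> x \<and> F_infinity f \<phi> C = range x \<and>
            (\<forall>z. bi_infinite_path f \<phi> z \<and> range z \<subseteq> C \<longrightarrow> (\<exists>k. \<forall>n. z n = x (n + k))))"
    if "class_IF f \<phi> C"
  proof (intro conjI ballI)
    have inf: "infinite C" and fin: "\<And>y. y \<in> C \<Longrightarrow> finite (foil \<phi> ?F y)"
      using that by (auto simp: class_IF_def foils)
    show "acyclic_component f \<phi> C"
      by (rule regular_infinite_component_acyclic[OF reg x Cx inf])
    show "\<exists>L' \<in> foils_of f \<phi> C. \<forall>y \<in> L'. ?F y \<in> L" if L: "L \<in> foils_of f \<phi> C" for L
    proof -
      obtain u where u: "u \<in> C" "L = foil \<phi> ?F u" using L by (auto simp: foils)
      obtain z where z: "z \<in> \<phi>" "coalesce ?F u (?F z)"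
        using ex_junior[OF x, of u] u(1) inf fin by (auto simp: Cx)
      have "connected_by ?F x u" using u(1) by (simp add: Cx component_def)
      also note coalesce_imp_connected_by[OF z(2)]
      also have "connected_by ?F (?F z) z"
        using connected_by_sym[OF connected_by_funpow[of ?F z 1]] by simp
      finally have "z \<in> C" using z(1) by (simp add: Cx component_def)
      moreover have "?F y \<in> L" if "y \<in> foil \<phi> ?F z" for y
      proof -
        have "y \<in> \<phi>" "coalesce ?F z y" using that by (simp_all add: foil_def)
        then show ?thesis
          using coalesce_trans[OF z(2) coalesce_step] closed by (simp add: u(2) foil_def)
      qed
      ultimately show ?thesis by (auto simp: foils)
    qed
    obtain y where y: "y \<in> C" "ancient \<phi> ?F y"
      using ex_ancient[OF x] inf fin by (auto simp: Cx)
    obtain w :: "int \<Rightarrow> 'a" where w: "\<And>n. w n \<in> \<phi>" "\<And>n. ?F (w n) = w (n + 1)" and w0: "w 0 = y"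
      using bi_infinite_orbit[OF y(2)] by blast
    have Cw: "C = component \<phi> ?F (w 0)"
      unfolding w0 Cx using y(1) by (intro component_eq) (simp add: Cx component_def)
    show "\<exists>x. bi_infinite_path f \<phi> x \<and> F_infinity f \<phi> C = range x \<and>
            (\<forall>z. bi_infinite_path f \<phi> z \<and> range z \<subseteq> C \<longrightarrow> (\<exists>k. \<forall>n. z n = x (n + k)))"
    proof (intro exI[of _ w] conjI allI impI)
      show "bi_infinite_path f \<phi> w" using w by (simp add: bi_infinite_path_def)
      show "F_infinity f \<phi> C = range w"
        using Finf orbit_range[of w, OF w] by (simp add: Cw)
      fix z assume z: "bi_infinite_path f \<phi> z \<and> range z \<subseteq> C"
      show "\<exists>k. \<forall>n. z n = w (n + k)"
        using z by (intro orbit_unique[of w z, OF w]) (simp_all add: bi_infinite_path_def Cw)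
    qed
  qed
  have II: "acyclic_component f \<phi> C \<and> F_infinity f \<phi> C = {}" if "class_II f \<phi> C"
  proof
    have inf: "infinite C" and foils_inf: "\<And>y. y \<in> C \<Longrightarrow> infinite (foil \<phi> ?F y)"
      using that by (auto simp: class_II_def foils)
    show "acyclic_component f \<phi> C"
      by (rule regular_infinite_component_acyclic[OF reg x Cx inf])
    show "F_infinity f \<phi> C = {}"
      unfolding Finf using finite_foil_ancient foils_inf by blast
  qed
  show ?thesis using trichotomy FF IF II by blast
qed

section \<open>A measurable enumeration of the points of a configuration\<close>

abbreviation ecard :: "'b set \<Rightarrow> ennreal" where
  "ecard A \<equiv> emeasure (count_space UNIV) A"

lemma ecard_bij: "bij_betw g A B \<Longrightarrow> ecard A = ecard B"
  by (auto simp: emeasure_count_space bij_betw_finite bij_betw_same_card)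

lemma ecard_nat: "ecard {i::nat. P i} = (\<Sum>i. indicator {i. P i} i)"
  by (simp add: nn_integral_count_space_nat[symmetric])

lemma ecard_nat_prod: "ecard {(i::nat, j::nat). P i j} = (\<Sum>i. \<Sum>j. indicator {i. P i j} i)"
proof -
  have "ecard {(i, j). P i j} = (\<integral>\<^sup>+ p. indicator {(i, j). P i j} p \<partial>count_space UNIV)"
    by simp
  also have "\<dots> = (\<integral>\<^sup>+ i. \<integral>\<^sup>+ j. indicator {(i, j). P i j} (i, j) \<partial>count_space UNIV \<partial>count_space UNIV)"
    by (rule nn_integral_fst_count_space[symmetric])
  also have "\<dots> = (\<Sum>i. \<Sum>j. indicator {i. P i j} i)"
    by (simp add: nn_integral_count_space_nat indicator_def)
  finally show ?thesis .
qed

text \<open>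
  A countable base of the topology. Every point of a locally finite set is the only one in some
  member of the base, so the members that contain exactly one point enumerate all points, possibly
  with repetitions.
\<close>

definition basis_seq :: "nat \<Rightarrow> 'a::euclidean_space set" where
  "basis_seq = (SOME B. (\<forall>n. open (B n)) \<and> (\<forall>S. open S \<longrightarrow> (\<exists>k. S = \<Union>{B n |n. n \<in> k})))"

lemma basis_seq:
  "open (basis_seq n :: 'a::euclidean_space set)"
  "open (S :: 'a set) \<Longrightarrow> x \<in> S \<Longrightarrow> \<exists>n. x \<in> basis_seq n \<and> basis_seq n \<subseteq> S"
proof -
  let ?P = "\<lambda>B :: nat \<Rightarrow> 'a set. (\<forall>n. open (B n)) \<and> (\<forall>S. open S \<longrightarrow> (\<exists>k. S = \<Union>{B n |n. n \<in> k}))"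
  have "\<exists>B. ?P B"
    by (rule univ_second_countable_sequence[where 'a='a]) blast
  from someI_ex[OF this] have P: "?P basis_seq"
    unfolding basis_seq_def .
  then show "open (basis_seq n :: 'a set)" by simp
  assume S: "open S" "x \<in> S"
  obtain k where "S = \<Union>{basis_seq n |n. n \<in> k}"
    using conjunct2[OF P, rule_format, OF S(1)] by (rule exE)
  then show "\<exists>n. x \<in> basis_seq n \<and> basis_seq n \<subseteq> S"
    using S(2) by blast
qed

definition isolates :: "'a::euclidean_space set \<Rightarrow> nat \<Rightarrow> bool" where
  "isolates \<phi> i \<longleftrightarrow> (\<exists>x. \<phi> \<inter> basis_seq i = {x})"

definition point_at :: "'a::euclidean_space set \<Rightarrow> nat \<Rightarrow> 'a" where
  "point_at \<phi> i = (if isolates \<phi> i then the_elem (\<phi> \<inter> basis_seq i) else 0)"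

text \<open>
  Counting points requires an enumeration without repetitions.
\<close>

definition first_index :: "'a::euclidean_space set \<Rightarrow> nat \<Rightarrow> bool" where
  "first_index \<phi> i \<longleftrightarrow> isolates \<phi> i \<and> (\<forall>j<i. isolates \<phi> j \<longrightarrow> point_at \<phi> j \<noteq> point_at \<phi> i)"

lemma isolatesD:
  assumes "isolates \<phi> i"
  shows "\<phi> \<inter> basis_seq i = {point_at \<phi> i}"
proof -
  obtain x where "\<phi> \<inter> basis_seq i = {x}"
    using assms unfolding isolates_def by (rule exE)
  with assms show ?thesis
    by (simp add: point_at_def)
qed

lemma point_at_in: "isolates \<phi> i \<Longrightarrow> point_at \<phi> i \<in> \<phi>"
  using isolatesD by blast

lemma ex_index:
  assumes "\<phi> \<in> configs" "x \<in> \<phi>"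
  shows "\<exists>i. isolates \<phi> i \<and> point_at \<phi> i = x"
proof -
  \<comment> \<open>removing the other points of the configuration from a ball around \<open>x\<close> leaves an open set\<close>
  let ?A = "\<phi> \<inter> ball x 1 - {x}"
  have "finite ?A"
    using assms(1) by (simp add: configs_def)
  then have "open (ball x 1 - ?A)"
    by (simp add: open_Diff finite_imp_closed)
  then obtain i where "x \<in> basis_seq i" "basis_seq i \<subseteq> ball x 1 - ?A"
    using basis_seq(2)[of "ball x 1 - ?A" x] by auto
  then have "\<phi> \<inter> basis_seq i = {x}"
    using assms(2) by auto
  then show ?thesis
    by (intro exI[of _ i]) (simp add: isolates_def point_at_def)
qed

lemma ex_first_index:
  assumes "\<phi> \<in> configs" "x \<in> \<phi>"
  shows "\<exists>i. first_index \<phi> i \<and> point_at \<phi> i = x"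
proof -
  obtain i where "isolates \<phi> i \<and> point_at \<phi> i = x" "\<forall>j<i. \<not> (isolates \<phi> j \<and> point_at \<phi> j = x)"
    using ex_index[OF assms] exists_least_iff[of "\<lambda>i. isolates \<phi> i \<and> point_at \<phi> i = x"] by blast
  then show ?thesis
    by (intro exI[of _ i]) (auto simp: first_index_def)
qed

lemma ex_point_iff:
  assumes "\<phi> \<in> configs"
  shows "(\<exists>x\<in>\<phi>. P x) \<longleftrightarrow> (\<exists>i. isolates \<phi> i \<and> P (point_at \<phi> i))"
  using ex_index[OF assms] point_at_in by metis

lemma bij_first_index:
  assumes "\<phi> \<in> configs"
  shows "bij_betw (point_at \<phi>) {i. first_index \<phi> i \<and> P (point_at \<phi> i)} {x \<in> \<phi>. P x}"
proof (rule bij_betwI')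
  show "point_at \<phi> i = point_at \<phi> j \<longleftrightarrow> i = j"
    if "i \<in> {i. first_index \<phi> i \<and> P (point_at \<phi> i)}" "j \<in> {i. first_index \<phi> i \<and> P (point_at \<phi> i)}" for i j
    using that by (cases i j rule: linorder_cases) (auto simp: first_index_def)
  show "point_at \<phi> i \<in> {x \<in> \<phi>. P x}" if "i \<in> {i. first_index \<phi> i \<and> P (point_at \<phi> i)}" for i
    using that point_at_in by (auto simp: first_index_def)
  show "\<exists>i\<in>{i. first_index \<phi> i \<and> P (point_at \<phi> i)}. x = point_at \<phi> i" if "x \<in> {x \<in> \<phi>. P x}" for x
    using that ex_first_index[OF assms, of x] by auto
qed

lemma ecard_points:
  assumes "\<phi> \<in> configs"
  shows "ecard {x \<in> \<phi>. P x} = (\<Sum>i. indicator {i. first_index \<phi> i \<and> P (point_at \<phi> i)} i)"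
  using ecard_bij[OF bij_first_index[OF assms, of P]] by (simp add: ecard_nat[symmetric])

lemma ecard_point_pairs:
  assumes "\<phi> \<in> configs"
  shows "ecard {(x, y). x \<in> \<phi> \<and> y \<in> \<phi> \<and> P x y} =
    (\<Sum>i. \<Sum>j. indicator {i. first_index \<phi> i \<and> first_index \<phi> j \<and> P (point_at \<phi> i) (point_at \<phi> j)} i)"
proof -
  note b = bij_first_index[OF assms, of "\<lambda>_. True", simplified]
  have "bij_betw (map_prod (point_at \<phi>) (point_at \<phi>))
      {p \<in> Collect (first_index \<phi>) \<times> Collect (first_index \<phi>). P (point_at \<phi> (fst p)) (point_at \<phi> (snd p))}
      {q \<in> \<phi> \<times> \<phi>. P (fst q) (snd q)}"
    unfolding bij_betw_def
  proof
    show "inj_on (map_prod (point_at \<phi>) (point_at \<phi>))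
      {p \<in> Collect (first_index \<phi>) \<times> Collect (first_index \<phi>). P (point_at \<phi> (fst p)) (point_at \<phi> (snd p))}"
      using bij_betw_imp_inj_on[OF b] by (auto simp: inj_on_def)
    show "map_prod (point_at \<phi>) (point_at \<phi>) ` {p \<in> Collect (first_index \<phi>) \<times> Collect (first_index \<phi>).
        P (point_at \<phi> (fst p)) (point_at \<phi> (snd p))} = {q \<in> \<phi> \<times> \<phi>. P (fst q) (snd q)}" (is "?L = ?R")
    proof
      show "?L \<subseteq> ?R"
        by (auto simp: first_index_def point_at_in)
      show "?R \<subseteq> ?L"
      proof
        fix q assume q: "q \<in> ?R"
        then have "fst q \<in> \<phi>" "snd q \<in> \<phi>" by auto
        then obtain i j where ij: "first_index \<phi> i" "point_at \<phi> i = fst q" "first_index \<phi> j" "point_at \<phi> j = snd q"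
          using ex_first_index[OF assms] by blast
        show "q \<in> ?L"
        proof (rule image_eqI)
          show "q = map_prod (point_at \<phi>) (point_at \<phi>) (i, j)"
            using ij(2,4) by simp
          show "(i, j) \<in> {p \<in> Collect (first_index \<phi>) \<times> Collect (first_index \<phi>).
              P (point_at \<phi> (fst p)) (point_at \<phi> (snd p))}"
            using ij q by simp
        qed
      qed
    qed
  qed
  from ecard_bij[OF this] show ?thesis
    by (simp add: ecard_nat_prod[symmetric] case_prod_unfold mem_Times_iff conj_assoc)
qed

lemma space_config_space [simp]: "space config_space = configs"
  unfolding config_space_def by (rule space_measure_of) auto

lemma measurable_point_count [measurable]:
  assumes "B \<in> sets borel"
  shows "(\<lambda>\<phi>. point_count \<phi> B) \<in> borel_measurable config_space"
proof (rule measurableI)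
  fix A :: "ennreal set" assume "A \<in> sets borel"
  then have "{\<phi> \<in> configs. point_count \<phi> B \<in> A} \<in> sets config_space"
    using assms unfolding config_space_def by (subst sets_measure_of) auto
  then show "(\<lambda>\<phi>. point_count \<phi> B) -` A \<inter> space config_space \<in> sets config_space"
    by (simp add: vimage_def Int_def conj_commute)
qed auto

lemma measurable_config_spaceI:
  fixes g :: "'b \<Rightarrow> 'a::euclidean_space set"
  assumes "\<And>\<omega>. \<omega> \<in> space M \<Longrightarrow> g \<omega> \<in> configs"
    and m: "\<And>B. B \<in> sets borel \<Longrightarrow> (\<lambda>\<omega>. point_count (g \<omega>) B) \<in> borel_measurable M"
  shows "g \<in> measurable M config_space"
  unfolding config_space_def
proof (rule measurable_measure_of)
  show "g \<in> space M \<rightarrow> configs"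
    using assms(1) by auto
  fix Y :: "'a set set" assume "Y \<in> {{\<phi> \<in> configs. point_count \<phi> B \<in> A} |B A. B \<in> sets borel \<and> A \<in> sets (borel :: ennreal measure)}"
  then obtain B and A :: "ennreal set" where BA: "B \<in> sets borel" "A \<in> sets borel" "Y = {\<phi> \<in> configs. point_count \<phi> B \<in> A}"
    by auto
  have "g -` Y \<inter> space M = (\<lambda>\<omega>. point_count (g \<omega>) B) -` A \<inter> space M"
    using BA(3) assms(1) by auto
  then show "g -` Y \<inter> space M \<in> sets M"
    using measurable_sets[OF m[OF BA(1)] BA(2)] by simp
qed auto

lemma ecard_eq_1_iff: "ecard A = 1 \<longleftrightarrow> (\<exists>x. A = {x})"
proof
  assume "ecard A = 1"
  then have "card A = 1"
    by (auto simp: emeasure_count_space split: if_splits)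
  then show "\<exists>x. A = {x}" by (rule card_1_singletonE) auto
qed (auto simp: emeasure_count_space)

lemma basis_seq_sets [measurable]: "basis_seq n \<in> sets borel"
  by (rule borel_open[OF basis_seq(1)])

lemma pred_isolates [measurable]: "Measurable.pred config_space (\<lambda>\<phi>. isolates \<phi> i)"
proof -
  have "isolates \<phi> i \<longleftrightarrow> point_count \<phi> (basis_seq i) = 1" for \<phi> :: "'a set"
    by (simp add: isolates_def point_count_def ecard_eq_1_iff)
  then show ?thesis by simp
qed

lemma measurable_point_at [measurable]: "(\<lambda>\<phi>. point_at \<phi> i) \<in> borel_measurable config_space"
proof (rule measurableI)
  fix A :: "'a set" assume A [measurable]: "A \<in> sets borel"
  have "point_at \<phi> i \<in> A \<longleftrightarrow> (if isolates \<phi> i then point_count \<phi> (basis_seq i \<inter> A) = 1 else 0 \<in> A)" for \<phi>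
  proof (cases "isolates \<phi> i")
    case True
    then have eq: "\<phi> \<inter> (basis_seq i \<inter> A) = {point_at \<phi> i} \<inter> A"
      using isolatesD by blast
    have "(\<exists>x. {point_at \<phi> i} \<inter> A = {x}) \<longleftrightarrow> point_at \<phi> i \<in> A"
      by (cases "point_at \<phi> i \<in> A") simp_all
    with True show ?thesis
      unfolding point_count_def ecard_eq_1_iff eq by simp
  next
    case False
    then show ?thesis by (simp add: point_at_def)
  qed
  then have "(\<lambda>\<phi>. point_at \<phi> i) -` A \<inter> space config_space = {\<phi> \<in> space config_space.
    (if isolates \<phi> i then point_count \<phi> (basis_seq i \<inter> A) = 1 else 0 \<in> A)}"
    by auto
  also have "\<dots> \<in> sets config_space"
    by measurable
  finally show "(\<lambda>\<phi>. point_at \<phi> i) -` A \<inter> space config_space \<in> sets config_space" .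
qed auto

lemma pred_first_index [measurable]: "Measurable.pred config_space (\<lambda>\<phi>. first_index \<phi> i)"
  unfolding first_index_def by measurable

text \<open>
  The values of a property at the enumerated points. They are kept folded, so that measurability is
  proved for them as a whole: on configurations without an \<open>i\<close>-th isolated point,
  nothing is known about the measurability of the property at the default value of
  \<open>point_at\<close>.
\<close>

definition pred_at :: "('a::euclidean_space set \<Rightarrow> 'a \<Rightarrow> bool) \<Rightarrow> nat \<Rightarrow> 'a set \<Rightarrow> bool" where
  "pred_at P i \<phi> \<longleftrightarrow> isolates \<phi> i \<and> P \<phi> (point_at \<phi> i)"

definition rel_at :: "('a::euclidean_space set \<Rightarrow> 'a \<Rightarrow> 'a \<Rightarrow> bool) \<Rightarrow> nat \<Rightarrow> nat \<Rightarrow> 'a set \<Rightarrow> bool" where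
  "rel_at R i j \<phi> \<longleftrightarrow> isolates \<phi> i \<and> isolates \<phi> j \<and> R \<phi> (point_at \<phi> i) (point_at \<phi> j)"

lemma measurable_ecard_points:
  assumes [measurable]: "\<And>i. Measurable.pred config_space (pred_at P i)"
  shows "(\<lambda>\<phi>. ecard {x \<in> \<phi>. P \<phi> x}) \<in> borel_measurable config_space"
proof -
  have eq: "ecard {x \<in> \<phi>. P \<phi> x} = (\<Sum>i. indicator {\<phi>. first_index \<phi> i \<and> pred_at P i \<phi>} \<phi>)"
    if "\<phi> \<in> configs" for \<phi>
    unfolding ecard_points[OF that]
    by (intro suminf_cong) (auto simp: indicator_def first_index_def pred_at_def)
  have "(\<lambda>\<phi>. \<Sum>i. indicator {\<phi>. first_index \<phi> i \<and> pred_at P i \<phi>} \<phi> :: ennreal)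
      \<in> borel_measurable config_space"
    by measurable
  then show ?thesis
    by (subst measurable_cong[OF eq]) simp_all
qed

lemma measurable_ecard_point_pairs:
  assumes [measurable]: "\<And>i j. Measurable.pred config_space (rel_at R i j)"
  shows "(\<lambda>\<phi>. ecard {(x, y). x \<in> \<phi> \<and> y \<in> \<phi> \<and> R \<phi> x y}) \<in> borel_measurable config_space"
proof -
  have eq: "ecard {(x, y). x \<in> \<phi> \<and> y \<in> \<phi> \<and> R \<phi> x y} =
      (\<Sum>i. \<Sum>j. indicator {\<phi>. first_index \<phi> i \<and> first_index \<phi> j \<and> rel_at R i j \<phi>} \<phi>)"
    if "\<phi> \<in> configs" for \<phi>
    unfolding ecard_point_pairs[OF that]
    by (intro suminf_cong) (auto simp: indicator_def first_index_def rel_at_def)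
  have "(\<lambda>\<phi>. \<Sum>i. \<Sum>j. indicator {\<phi>. first_index \<phi> i \<and> first_index \<phi> j \<and> rel_at R i j \<phi>} \<phi> :: ennreal)
      \<in> borel_measurable config_space"
    by measurable
  then show ?thesis
    by (subst measurable_cong[OF eq]) simp_all
qed

lemma image_add_right_eq: "(\<lambda>x. x + t) ` B = {x. x - t \<in> B}" for t :: "'a::group_add"
  by (auto simp: image_iff) (metis diff_add_cancel)

text \<open>
  Although the translation vector depends on the configuration, the number of translated points in a
  Borel set is the number of points \<open>x\<close> for which the difference of \<open>x\<close>
  and the chosen point lies in the set, a measurable function of the configuration.
\<close>

lemma measurable_translate_point_at:
  "(\<lambda>\<phi>. translate (point_at \<phi> i) \<phi>) \<in> measurable config_space config_space"
proof (rule measurable_config_spaceI)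
  fix B :: "'a set" assume [measurable]: "B \<in> sets borel"
  have "point_count (translate (point_at \<phi> i) \<phi>) B = ecard {x \<in> \<phi>. x - point_at \<phi> i \<in> B}" for \<phi>
    by (simp add: point_count_translate image_add_right_eq) (simp add: point_count_def Int_def)
  then show "(\<lambda>\<phi>. point_count (translate (point_at \<phi> i) \<phi>) B) \<in> borel_measurable config_space"
    by (simp, intro measurable_ecard_points) (unfold pred_at_def, measurable)
qed (simp add: translate_configs)

section \<open>Flow-adapted relations\<close>

text \<open>
  Measurable properties of a point of a configuration that commute with translations. These are the
  distinguished subsets to which the mass transport principle applies, and the adapted relations
  below are the transport rules. Both classes are closed under the logical operations and under
  quantification over points.
\<close>

definition adapted_pred :: "('a::euclidean_space set \<Rightarrow> 'a \<Rightarrow> bool) \<Rightarrow> bool" where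
  "adapted_pred P \<longleftrightarrow> (\<forall>t \<phi> x. P (translate t \<phi>) (x - t) = P \<phi> x) \<and>
     (\<forall>i. Measurable.pred config_space (pred_at P i))"

definition adapted_rel :: "('a::euclidean_space set \<Rightarrow> 'a \<Rightarrow> 'a \<Rightarrow> bool) \<Rightarrow> bool" where
  "adapted_rel R \<longleftrightarrow> (\<forall>t \<phi> x y. R (translate t \<phi>) (x - t) (y - t) = R \<phi> x y) \<and>
     (\<forall>i j. Measurable.pred config_space (rel_at R i j))"

lemma adapted_predD:
  assumes "adapted_pred P"
  shows "P (translate t \<phi>) (x - t) = P \<phi> x" and "Measurable.pred config_space (pred_at P i)"
  using assms by (auto simp: adapted_pred_def)

lemma adapted_relD:
  assumes "adapted_rel R"
  shows "R (translate t \<phi>) (x - t) (y - t) = R \<phi> x y" and "Measurable.pred config_space (rel_at R i j)"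
  using assms by (auto simp: adapted_rel_def)

lemma adapted_predI:
  assumes "\<And>t \<phi> x. P (translate t \<phi>) (x - t) = P \<phi> x"
    and "\<And>i \<phi>. \<phi> \<in> configs \<Longrightarrow> pred_at P i \<phi> = Q i \<phi>" and "\<And>i. Measurable.pred config_space (Q i)"
  shows "adapted_pred P"
  unfolding adapted_pred_def
proof (intro conjI allI assms(1))
  fix i
  have "Measurable.pred config_space (pred_at P i) \<longleftrightarrow> Measurable.pred config_space (Q i)"
    by (rule measurable_cong) (simp add: assms(2))
  with assms(3) show "Measurable.pred config_space (pred_at P i)" by blast
qed

lemma adapted_relI:
  assumes "\<And>t \<phi> x y. R (translate t \<phi>) (x - t) (y - t) = R \<phi> x y"
    and "\<And>i j \<phi>. \<phi> \<in> configs \<Longrightarrow> rel_at R i j \<phi> = Q i j \<phi>" and "\<And>i j. Measurable.pred config_space (Q i j)"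
  shows "adapted_rel R"
  unfolding adapted_rel_def
proof (intro conjI allI assms(1))
  fix i j
  have "Measurable.pred config_space (rel_at R i j) \<longleftrightarrow> Measurable.pred config_space (Q i j)"
    by (rule measurable_cong) (simp add: assms(2))
  with assms(3) show "Measurable.pred config_space (rel_at R i j)" by blast
qed

lemma adapted_pred_not:
  assumes "adapted_pred P" shows "adapted_pred (\<lambda>\<phi> x. \<not> P \<phi> x)"
proof (rule adapted_predI[where Q = "\<lambda>i \<phi>. isolates \<phi> i \<and> \<not> pred_at P i \<phi>"])
  note [measurable] = adapted_predD(2)[OF assms]
  show "Measurable.pred config_space (\<lambda>\<phi>. isolates \<phi> i \<and> \<not> pred_at P i \<phi>)" for i
    by measurable
qed (auto simp: pred_at_def adapted_predD(1)[OF assms])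

lemma adapted_pred_conj:
  assumes "adapted_pred P" "adapted_pred Q" shows "adapted_pred (\<lambda>\<phi> x. P \<phi> x \<and> Q \<phi> x)"
proof (rule adapted_predI[where Q = "\<lambda>i \<phi>. pred_at P i \<phi> \<and> pred_at Q i \<phi>"])
  note [measurable] = assms[THEN adapted_predD(2)]
  show "Measurable.pred config_space (\<lambda>\<phi>. pred_at P i \<phi> \<and> pred_at Q i \<phi>)" for i
    by measurable
qed (auto simp: pred_at_def assms[THEN adapted_predD(1)])

lemma adapted_pred_ex_nat:
  fixes P :: "nat \<Rightarrow> _"
  assumes "\<And>n. adapted_pred (P n)" shows "adapted_pred (\<lambda>\<phi> x. \<exists>n. P n \<phi> x)"
proof (rule adapted_predI[where Q = "\<lambda>i \<phi>. \<exists>n. pred_at (P n) i \<phi>"])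
  note [measurable] = assms[THEN adapted_predD(2)]
  show "Measurable.pred config_space (\<lambda>\<phi>. \<exists>n. pred_at (P n) i \<phi>)" for i
    by measurable
qed (auto simp: pred_at_def assms[THEN adapted_predD(1)])

lemma adapted_pred_all_nat:
  fixes P :: "nat \<Rightarrow> _"
  assumes "\<And>n. adapted_pred (P n)" shows "adapted_pred (\<lambda>\<phi> x. \<forall>n. P n \<phi> x)"
  using adapted_pred_not[OF adapted_pred_ex_nat[OF adapted_pred_not[OF assms]]] by simp

lemma adapted_rel_conj:
  assumes "adapted_rel R" "adapted_rel S" shows "adapted_rel (\<lambda>\<phi> x y. R \<phi> x y \<and> S \<phi> x y)"
proof (rule adapted_relI[where Q = "\<lambda>i j \<phi>. rel_at R i j \<phi> \<and> rel_at S i j \<phi>"])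
  note [measurable] = assms[THEN adapted_relD(2)]
  show "Measurable.pred config_space (\<lambda>\<phi>. rel_at R i j \<phi> \<and> rel_at S i j \<phi>)" for i j
    by measurable
qed (auto simp: rel_at_def assms[THEN adapted_relD(1)])

lemma adapted_rel_ex_nat:
  fixes R :: "nat \<Rightarrow> _"
  assumes "\<And>n. adapted_rel (R n)" shows "adapted_rel (\<lambda>\<phi> x y. \<exists>n. R n \<phi> x y)"
proof (rule adapted_relI[where Q = "\<lambda>i j \<phi>. \<exists>n. rel_at (R n) i j \<phi>"])
  note [measurable] = assms[THEN adapted_relD(2)]
  show "Measurable.pred config_space (\<lambda>\<phi>. \<exists>n. rel_at (R n) i j \<phi>)" for i j
    by measurable
qed (auto simp: rel_at_def assms[THEN adapted_relD(1)])

lemma adapted_rel_converse: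
  assumes "adapted_rel R" shows "adapted_rel (\<lambda>\<phi> x y. R \<phi> y x)"
  by (rule adapted_relI[where Q = "\<lambda>i j. rel_at R j i"])
    (auto simp: rel_at_def[abs_def] adapted_relD(1)[OF assms] intro: adapted_relD(2)[OF assms, unfolded rel_at_def[abs_def]])

lemma adapted_rel_fst:
  assumes "adapted_pred P" shows "adapted_rel (\<lambda>\<phi> x y. P \<phi> x)"
proof (rule adapted_relI[where Q = "\<lambda>i j \<phi>. isolates \<phi> j \<and> pred_at P i \<phi>"])
  note [measurable] = assms[THEN adapted_predD(2)]
  show "Measurable.pred config_space (\<lambda>\<phi>. isolates \<phi> j \<and> pred_at P i \<phi>)" for i j
    by measurable
qed (auto simp: pred_at_def rel_at_def assms[THEN adapted_predD(1)])

lemma adapted_pred_diag: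
  assumes "adapted_rel R" shows "adapted_pred (\<lambda>\<phi> x. R \<phi> x x)"
  by (rule adapted_predI[where Q = "\<lambda>i. rel_at R i i"])
    (simp_all add: pred_at_def rel_at_def adapted_relD[OF assms])

lemma ex_translate: "(\<exists>y\<in>translate t \<phi>. P y) \<longleftrightarrow> (\<exists>y\<in>\<phi>. P (y - t))"
  by (auto simp: translate_def)

lemma adapted_pred_ex:
  assumes "adapted_rel R" shows "adapted_pred (\<lambda>\<phi> x. \<exists>y\<in>\<phi>. R \<phi> x y)"
proof (rule adapted_predI[where Q = "\<lambda>i \<phi>. \<exists>j. rel_at R i j \<phi>"])
  note [measurable] = adapted_relD(2)[OF assms]
  show "Measurable.pred config_space (\<lambda>\<phi>. \<exists>j. rel_at R i j \<phi>)" for i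
    by measurable
qed (auto simp: pred_at_def rel_at_def ex_point_iff ex_translate adapted_relD(1)[OF assms])

lemma adapted_rel_comp:
  assumes "adapted_rel R" "adapted_rel S" shows "adapted_rel (\<lambda>\<phi> x z. \<exists>y\<in>\<phi>. R \<phi> x y \<and> S \<phi> y z)"
proof (rule adapted_relI[where Q = "\<lambda>i j \<phi>. \<exists>k. rel_at R i k \<phi> \<and> rel_at S k j \<phi>"])
  note [measurable] = assms[THEN adapted_relD(2)]
  show "Measurable.pred config_space (\<lambda>\<phi>. \<exists>k. rel_at R i k \<phi> \<and> rel_at S k j \<phi>)" for i j
    by measurable
qed (auto simp: rel_at_def ex_point_iff ex_translate assms[THEN adapted_relD(1)])

lemma Collect_translate: "{y \<in> translate t \<phi>. P y} = (\<lambda>y. y - t) ` {y \<in> \<phi>. P (y - t)}"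
  by (auto simp: translate_def)

lemma ecard_le_iff: "ecard A \<le> of_nat n \<longleftrightarrow> finite A \<and> card A \<le> n"
  by (auto simp: emeasure_count_space top_unique)

lemma adapted_pred_out_degree_le:
  assumes "adapted_rel R" shows "adapted_pred (\<lambda>\<phi> x. ecard {y \<in> \<phi>. R \<phi> x y} \<le> of_nat n)"
proof (rule adapted_predI[where Q = "\<lambda>i \<phi>. isolates \<phi> i \<and>
    ecard {y \<in> \<phi>. isolates \<phi> i \<and> R \<phi> (point_at \<phi> i) y} \<le> of_nat n"])
  fix t \<phi> x
  have "ecard {y \<in> translate t \<phi>. R (translate t \<phi>) (x - t) y} = ecard {y \<in> \<phi>. R \<phi> x y}"
    unfolding Collect_translate adapted_relD(1)[OF assms]
    by (rule ecard_bij[OF inj_on_imp_bij_betw, symmetric]) (simp add: inj_on_def)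
  then show "(ecard {y \<in> translate t \<phi>. R (translate t \<phi>) (x - t) y} \<le> of_nat n) =
    (ecard {y \<in> \<phi>. R \<phi> x y} \<le> of_nat n)" by simp
next
  fix i
  have "pred_at (\<lambda>\<phi> y. isolates \<phi> i \<and> R \<phi> (point_at \<phi> i) y) j = rel_at R i j" for j
    by (auto simp: pred_at_def rel_at_def fun_eq_iff)
  then have [measurable]: "(\<lambda>\<phi>. ecard {y \<in> \<phi>. isolates \<phi> i \<and> R \<phi> (point_at \<phi> i) y}) \<in> borel_measurable config_space"
    by (intro measurable_ecard_points) (simp add: adapted_relD(2)[OF assms])
  show "Measurable.pred config_space
      (\<lambda>\<phi>. isolates \<phi> i \<and> ecard {y \<in> \<phi>. isolates \<phi> i \<and> R \<phi> (point_at \<phi> i) y} \<le> of_nat n)"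
    by measurable
qed (auto simp: pred_at_def)

lemma adapted_pred_finite:
  assumes "adapted_rel R" shows "adapted_pred (\<lambda>\<phi> x. finite {y \<in> \<phi>. R \<phi> x y})"
proof -
  have "(\<lambda>\<phi> x. finite {y \<in> \<phi>. R \<phi> x y}) = (\<lambda>\<phi> x. \<exists>n. ecard {y \<in> \<phi>. R \<phi> x y} \<le> of_nat n)"
    unfolding ecard_le_iff by (intro ext) auto
  then show ?thesis
    by (simp only: adapted_pred_ex_nat[OF adapted_pred_out_degree_le[OF assms]])
qed

section \<open>Mass transport\<close>

definition unit_cube :: "'a::euclidean_space \<Rightarrow> 'a set" where
  "unit_cube z = {x. \<forall>b\<in>Basis. z \<bullet> b \<le> x \<bullet> b \<and> x \<bullet> b < z \<bullet> b + 1}"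

definition integer_points :: "'a::euclidean_space set" where
  "integer_points = {z. \<forall>b\<in>Basis. z \<bullet> b \<in> \<int>}"

lemma unit_cube_sets [measurable]: "unit_cube z \<in> sets borel"
  unfolding unit_cube_def by measurable

lemma diff_in_unit_cube_iff: "x - t \<in> unit_cube z \<longleftrightarrow> x \<in> unit_cube (z + t)"
  unfolding unit_cube_def by (auto simp: inner_diff_left inner_add_left algebra_simps)

lemma countable_integer_points: "countable (integer_points :: 'a::euclidean_space set)"
proof -
  have "integer_points \<subseteq> (\<lambda>g. \<Sum>b\<in>Basis. of_int (g b) *\<^sub>R b) ` (Pi\<^sub>E Basis (\<lambda>_::'a. UNIV :: int set))"
  proof
    fix z :: 'a assume z: "z \<in> integer_points"
    have "(\<Sum>b\<in>Basis. of_int \<lfloor>z \<bullet> b\<rfloor> *\<^sub>R b) = (\<Sum>b\<in>Basis. (z \<bullet> b) *\<^sub>R b)"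
      using z by (intro sum.cong) (auto simp: integer_points_def elim!: Ints_cases)
    also have "\<dots> = z" by (rule euclidean_representation)
    finally have eq: "(\<Sum>b\<in>Basis. of_int \<lfloor>z \<bullet> b\<rfloor> *\<^sub>R b) = z" .
    show "z \<in> (\<lambda>g. \<Sum>b\<in>Basis. of_int (g b) *\<^sub>R b) ` (Pi\<^sub>E Basis (\<lambda>_. UNIV))"
    proof (rule image_eqI[where x = "\<lambda>b\<in>Basis. \<lfloor>z \<bullet> b\<rfloor>"])
      show "z = (\<Sum>b\<in>Basis. of_int ((\<lambda>b\<in>Basis. \<lfloor>z \<bullet> b\<rfloor>) b) *\<^sub>R b)"
        by (simp add: eq)
    qed simp
  qed
  then show ?thesis
    by (rule countable_subset) (intro countable_image countable_PiE; simp)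
qed

lemma disjoint_unit_cubes: "disjoint_family_on unit_cube integer_points"
  unfolding disjoint_family_on_def
proof safe
  fix z z' x :: 'a
  assume z: "z \<in> integer_points" "z' \<in> integer_points" and x: "x \<in> unit_cube z" "x \<in> unit_cube z'"
    and ne: "z \<noteq> z'"
  have "z \<bullet> b = z' \<bullet> b" if b: "b \<in> Basis" for b
  proof -
    have "z \<bullet> b \<in> \<int>" "z' \<bullet> b \<in> \<int>"
      using z b by (simp_all add: integer_points_def)
    then obtain k l where kl: "z \<bullet> b = of_int k" "z' \<bullet> b = of_int l"
      by (elim Ints_cases)
    note kl
    moreover have "z \<bullet> b \<le> x \<bullet> b" "x \<bullet> b < z \<bullet> b + 1" "z' \<bullet> b \<le> x \<bullet> b" "x \<bullet> b < z' \<bullet> b + 1"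
      using x b by (auto simp: unit_cube_def)
    ultimately have "real_of_int k < of_int l + 1" "real_of_int l < of_int k + 1"
      by linarith+
    then have "k = l" by linarith
    with kl show ?thesis by simp
  qed
  then have "z = z'" by (rule euclidean_eqI)
  with ne show "x \<in> {}" by contradiction
qed

lemma ex_unit_cube: "\<exists>z\<in>integer_points. x \<in> unit_cube z"
proof
  let ?z = "\<Sum>b\<in>Basis. of_int \<lfloor>x \<bullet> b\<rfloor> *\<^sub>R b"
  have "?z \<bullet> b = of_int \<lfloor>x \<bullet> b\<rfloor>" if "b \<in> Basis" for b
    using that by (rule inner_sum_left_Basis)
  then show "?z \<in> integer_points" "x \<in> unit_cube ?z"
    by (auto simp: integer_points_def unit_cube_def)
qed

text \<open>
  The number of pairs in the relation with first component in \<open>A\<close> and second component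
  in \<open>B\<close>: the mass sent from \<open>A\<close> to \<open>B\<close> if every point sends
  unit mass to each point it is related to.
\<close>

definition mass :: "('a::euclidean_space set \<Rightarrow> 'a \<Rightarrow> 'a \<Rightarrow> bool) \<Rightarrow> 'a set \<Rightarrow> 'a set \<Rightarrow> 'a set \<Rightarrow> ennreal" where
  "mass R \<phi> A B = ecard {(x, y). x \<in> \<phi> \<and> y \<in> \<phi> \<and> x \<in> A \<and> y \<in> B \<and> R \<phi> x y}"

lemma measurable_mass [measurable]:
  assumes "adapted_rel R" and [measurable]: "A \<in> sets borel" "B \<in> sets borel"
  shows "(\<lambda>\<phi>. mass R \<phi> A B) \<in> borel_measurable config_space"
  unfolding mass_def
proof (rule measurable_ecard_point_pairs)
  fix i j
  note [measurable] = adapted_relD(2)[OF assms(1)]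
  have "rel_at (\<lambda>\<phi> x y. x \<in> A \<and> y \<in> B \<and> R \<phi> x y) i j = (\<lambda>\<phi>. point_at \<phi> i \<in> A \<and> point_at \<phi> j \<in> B \<and> rel_at R i j \<phi>)"
    by (auto simp: rel_at_def fun_eq_iff)
  then show "Measurable.pred config_space (rel_at (\<lambda>\<phi> x y. x \<in> A \<and> y \<in> B \<and> R \<phi> x y) i j)"
    by simp
qed

lemma mass_translate:
  assumes "adapted_rel R"
  shows "mass R (translate t \<phi>) A B = mass R \<phi> {x. x - t \<in> A} {x. x - t \<in> B}"
proof -
  note cov = adapted_relD(1)[OF assms]
  have mem: "u \<in> translate t \<phi> \<longleftrightarrow> u + t \<in> \<phi>" for u
    by (auto simp: translate_def image_iff) (metis add_diff_cancel)
  have cov': "R (translate t \<phi>) u v = R \<phi> (u + t) (v + t)" for u v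
    using cov[of t \<phi> "u + t" "v + t"] by simp
  show ?thesis
    unfolding mass_def
    by (rule ecard_bij, rule bij_betw_byWitness[where f = "\<lambda>(x, y). (x + t, y + t)" and f' = "\<lambda>(x, y). (x - t, y - t)"])
      (auto simp: mem cov')
qed

lemma ecard_tile:
  "ecard S = (\<integral>\<^sup>+z. ecard {p \<in> S. g p \<in> unit_cube z} \<partial>count_space integer_points)"
proof -
  let ?X = "\<lambda>z. {p \<in> S. g p \<in> unit_cube z}"
  have "disjoint_family_on ?X integer_points"
    unfolding disjoint_family_on_def
  proof (intro ballI impI)
    fix z z' :: 'b assume "z \<in> integer_points" "z' \<in> integer_points" "z \<noteq> z'"
    then have "unit_cube z \<inter> unit_cube z' = {}"
      by (rule disjoint_unit_cubes[unfolded disjoint_family_on_def, rule_format])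
    then show "?X z \<inter> ?X z' = {}" by auto
  qed
  from emeasure_UN_countable[OF _ countable_integer_points this, of "count_space UNIV"]
  have "ecard (\<Union>(?X ` integer_points)) = (\<integral>\<^sup>+z. ecard (?X z) \<partial>count_space integer_points)"
    by simp
  also have "\<Union>(?X ` integer_points) = S"
    using ex_unit_cube by auto
  finally show ?thesis .
qed

lemma mass_tile_right:
  "mass R \<phi> A UNIV = (\<integral>\<^sup>+z. mass R \<phi> A (unit_cube z) \<partial>count_space integer_points)"
proof -
  have "{p \<in> {(x, y). x \<in> \<phi> \<and> y \<in> \<phi> \<and> x \<in> A \<and> y \<in> UNIV \<and> R \<phi> x y}. snd p \<in> unit_cube z} =
      {(x, y). x \<in> \<phi> \<and> y \<in> \<phi> \<and> x \<in> A \<and> y \<in> unit_cube z \<and> R \<phi> x y}" for z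
    by auto
  then show ?thesis
    unfolding mass_def by (subst ecard_tile[where g = snd]) simp
qed

lemma mass_tile_left:
  "mass R \<phi> UNIV B = (\<integral>\<^sup>+z. mass R \<phi> (unit_cube z) B \<partial>count_space integer_points)"
proof -
  have "{p \<in> {(x, y). x \<in> \<phi> \<and> y \<in> \<phi> \<and> x \<in> UNIV \<and> y \<in> B \<and> R \<phi> x y}. fst p \<in> unit_cube z} =
      {(x, y). x \<in> \<phi> \<and> y \<in> \<phi> \<and> x \<in> unit_cube z \<and> y \<in> B \<and> R \<phi> x y}" for z
    by auto
  then show ?thesis
    unfolding mass_def by (subst ecard_tile[where g = fst]) simp
qed

lemma mass_le_point_count:
  assumes "\<And>x. x \<in> \<phi> \<Longrightarrow> ecard {y \<in> \<phi>. R \<phi> x y} \<le> of_nat N"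
  shows "mass R \<phi> A UNIV \<le> of_nat N * point_count \<phi> A"
proof -
  let ?S = "{(x, y). x \<in> \<phi> \<and> y \<in> \<phi> \<and> x \<in> A \<and> y \<in> UNIV \<and> R \<phi> x y}"
  have "mass R \<phi> A UNIV = (\<integral>\<^sup>+ p. indicator ?S p \<partial>count_space UNIV)"
    by (simp add: mass_def)
  also have "\<dots> = (\<integral>\<^sup>+ x. \<integral>\<^sup>+ y. indicator ?S (x, y) \<partial>count_space UNIV \<partial>count_space UNIV)"
    by (rule nn_integral_fst_count_space[symmetric])
  also have "\<dots> \<le> (\<integral>\<^sup>+ x. of_nat N * indicator (\<phi> \<inter> A) x \<partial>count_space UNIV)"
  proof (rule nn_integral_mono)
    fix x
    have "(\<integral>\<^sup>+ y. indicator ?S (x, y) \<partial>count_space UNIV) = (\<integral>\<^sup>+ y. indicator {y. (x, y) \<in> ?S} y \<partial>count_space UNIV)"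
      by (simp add: indicator_def)
    also have "\<dots> = ecard {y. (x, y) \<in> ?S}" by simp
    also have "\<dots> \<le> of_nat N * indicator (\<phi> \<inter> A) x"
      using assms[of x] by (cases "x \<in> \<phi> \<inter> A") auto
    finally show "(\<integral>\<^sup>+ y. indicator ?S (x, y) \<partial>count_space UNIV) \<le> of_nat N * indicator (\<phi> \<inter> A) x" .
  qed
  also have "\<dots> = of_nat N * point_count \<phi> A"
    by (simp add: nn_integral_cmult point_count_def)
  finally show ?thesis .
qed

lemma AE_eq_of_le_of_nn_integral_eq:
  fixes f g :: "'b \<Rightarrow> ennreal"
  assumes [measurable]: "f \<in> borel_measurable M" "g \<in> borel_measurable M"
    and le: "AE x in M. f x \<le> g x"
    and eq: "(\<integral>\<^sup>+x. f x \<partial>M) = (\<integral>\<^sup>+x. g x \<partial>M)" and fin: "(\<integral>\<^sup>+x. f x \<partial>M) \<noteq> \<infinity>"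
  shows "AE x in M. f x = g x"
proof -
  have "(\<integral>\<^sup>+x. g x - f x \<partial>M) = (\<integral>\<^sup>+x. g x \<partial>M) - (\<integral>\<^sup>+x. f x \<partial>M)"
    using le fin by (intro nn_integral_diff) auto
  also have "\<dots> = 0"
    using eq fin by simp
  finally have "AE x in M. g x - f x = 0"
    by (subst (asm) nn_integral_0_iff_AE) auto
  moreover have "AE x in M. g x \<noteq> \<infinity>"
    using fin eq by (intro nn_integral_noteq_infinite) auto
  ultimately show ?thesis
    using le by eventually_elim (metis antisym diff_eq_0_iff_ennreal infinity_ennreal_def top.not_eq_extremum)
qed

context stationary_point_process
begin

lemma process_configs: "\<omega> \<in> space M \<Longrightarrow> \<Phi> \<omega> \<in> configs"
  using measurable_space[OF process_measurable] by simp

lemma nn_integral_translate: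
  assumes "h \<in> borel_measurable config_space"
  shows "(\<integral>\<^sup>+\<omega>. h (translate t (\<Phi> \<omega>)) \<partial>M) = (\<integral>\<^sup>+\<omega>. h (\<Phi> \<omega>) \<partial>M)"
proof -
  note [measurable] = assms process_measurable flow_measurable
  have "(\<integral>\<^sup>+\<omega>. h (\<Phi> \<omega>) \<partial>M) = (\<integral>\<^sup>+\<omega>. h (\<Phi> \<omega>) \<partial>(distr M M (\<theta> t)))"
    by (simp only: flow_invariant)
  also have "\<dots> = (\<integral>\<^sup>+\<omega>. h (\<Phi> (\<theta> t \<omega>)) \<partial>M)"
    by (rule nn_integral_distr) measurable
  also have "\<dots> = (\<integral>\<^sup>+\<omega>. h (translate t (\<Phi> \<omega>)) \<partial>M)"
    by (intro nn_integral_cong) (simp add: process_adapted)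
  finally show ?thesis by simp
qed

lemma nn_integral_point_count_unit_cube:
  "(\<integral>\<^sup>+\<omega>. point_count (\<Phi> \<omega>) (unit_cube z) \<partial>M) = intensity M \<Phi>"
proof -
  have "(\<integral>\<^sup>+\<omega>. point_count (translate z (\<Phi> \<omega>)) (unit_cube 0) \<partial>M) =
      (\<integral>\<^sup>+\<omega>. point_count (\<Phi> \<omega>) (unit_cube 0) \<partial>M)"
    by (rule nn_integral_translate) measurable
  moreover have "(\<lambda>x. x + z) ` unit_cube 0 = unit_cube z"
    by (simp add: image_add_right_eq diff_in_unit_cube_iff)
  ultimately show ?thesis
    by (simp add: point_count_translate intensity_def) (simp add: unit_cube_def)
qed

lemma measurable_mass_process [measurable]:
  assumes "adapted_rel R" and [measurable]: "A \<in> sets borel" "B \<in> sets borel"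
  shows "(\<lambda>\<omega>. mass R (\<Phi> \<omega>) A B) \<in> borel_measurable M"
  using measurable_compose[OF process_measurable measurable_mass[OF assms]] .

lemma nn_integral_mass_translate:
  assumes "adapted_rel R" "A \<in> sets borel" "B \<in> sets borel"
  shows "(\<integral>\<^sup>+\<omega>. mass R (\<Phi> \<omega>) {x. x - t \<in> A} {x. x - t \<in> B} \<partial>M) = (\<integral>\<^sup>+\<omega>. mass R (\<Phi> \<omega>) A B \<partial>M)"
  using nn_integral_translate[OF measurable_mass[OF assms], of t] by (simp add: mass_translate[OF assms(1)])

text \<open>
  The mass sent from the cube at \<open>0\<close> splits into the masses sent to the cubes at the
  integer points \<open>u\<close>. By stationarity these have the same expectations as the masses
  sent from the cubes at \<open>- u\<close> to the cube at \<open>0\<close>, and these add up to the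
  mass received by the cube at \<open>0\<close>.
\<close>

theorem mass_transport:
  assumes R: "adapted_rel R"
  shows "(\<integral>\<^sup>+\<omega>. mass R (\<Phi> \<omega>) (unit_cube z) UNIV \<partial>M) = (\<integral>\<^sup>+\<omega>. mass R (\<Phi> \<omega>) UNIV (unit_cube z) \<partial>M)"
proof -
  have "(\<integral>\<^sup>+\<omega>. mass R (\<Phi> \<omega>) (unit_cube 0) UNIV \<partial>M)
    = (\<integral>\<^sup>+u. \<integral>\<^sup>+\<omega>. mass R (\<Phi> \<omega>) (unit_cube 0) (unit_cube u) \<partial>M \<partial>count_space integer_points)"
    unfolding mass_tile_right
    by (rule nn_integral_count_space_nn_integral) (use R in \<open>auto intro: countable_integer_points\<close>)
  also have "\<dots> = (\<integral>\<^sup>+u. \<integral>\<^sup>+\<omega>. mass R (\<Phi> \<omega>) (unit_cube (- u)) (unit_cube 0) \<partial>M \<partial>count_space integer_points)"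
    using nn_integral_mass_translate[OF R, of "unit_cube 0" "unit_cube u" "- u" for u]
    by (simp add: diff_in_unit_cube_iff[of _ "- u" for u, simplified])
  also have "\<dots> = (\<integral>\<^sup>+u. \<integral>\<^sup>+\<omega>. mass R (\<Phi> \<omega>) (unit_cube u) (unit_cube 0) \<partial>M \<partial>count_space integer_points)"
    by (rule nn_integral_bij_count_space[where g = uminus], rule bij_betw_byWitness[where f' = uminus])
      (auto simp: integer_points_def)
  also have "\<dots> = (\<integral>\<^sup>+\<omega>. mass R (\<Phi> \<omega>) UNIV (unit_cube 0) \<partial>M)"
    unfolding mass_tile_left
    by (rule nn_integral_count_space_nn_integral[symmetric]) (use R in \<open>auto intro: countable_integer_points\<close>)
  finally show ?thesis
    using nn_integral_mass_translate[OF R, of "unit_cube 0" UNIV z] nn_integral_mass_translate[OF R, of UNIV "unit_cube 0" z]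
    by (simp add: diff_in_unit_cube_iff)
qed

lemma nn_integral_mass_finite:
  assumes "intensity M \<Phi> < \<infinity>" and "\<And>\<phi> x. ecard {y \<in> \<phi>. R \<phi> x y} \<le> of_nat N"
  shows "(\<integral>\<^sup>+\<omega>. mass R (\<Phi> \<omega>) (unit_cube z) UNIV \<partial>M) \<noteq> \<infinity>"
proof -
  have "(\<integral>\<^sup>+\<omega>. mass R (\<Phi> \<omega>) (unit_cube z) UNIV \<partial>M) \<le> (\<integral>\<^sup>+\<omega>. of_nat N * point_count (\<Phi> \<omega>) (unit_cube z) \<partial>M)"
    by (intro nn_integral_mono mass_le_point_count assms(2))
  also have "\<dots> = of_nat N * intensity M \<Phi>"
    by (subst nn_integral_cmult) (simp_all add: nn_integral_point_count_unit_cube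
      measurable_compose[OF process_measurable measurable_point_count])
  also have "\<dots> < \<infinity>"
    using assms(1) by (simp add: ennreal_mult_less_top of_nat_less_top)
  finally show ?thesis by simp
qed

lemma AE_finite_in_degree_bounded:
  assumes fin: "intensity M \<Phi> < \<infinity>" and R: "adapted_rel R" and N: "\<And>\<phi> x. ecard {y \<in> \<phi>. R \<phi> x y} \<le> of_nat N"
  shows "AE \<omega> in M. \<forall>y\<in>\<Phi> \<omega>. finite {x \<in> \<Phi> \<omega>. R (\<Phi> \<omega>) x y}"
proof -
  have "AE \<omega> in M. \<forall>z\<in>integer_points. mass R (\<Phi> \<omega>) UNIV (unit_cube z) \<noteq> \<infinity>"
  proof (subst AE_ball_countable[OF countable_integer_points], intro ballI nn_integral_noteq_infinite)
    show "(\<integral>\<^sup>+\<omega>. mass R (\<Phi> \<omega>) UNIV (unit_cube z) \<partial>M) \<noteq> \<infinity>" for z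
      using nn_integral_mass_finite[OF fin N] by (simp add: mass_transport[OF R, symmetric])
  qed (use R in measurable)
  then show ?thesis
  proof eventually_elim
    case (elim \<omega>)
    show ?case
    proof
      fix y assume y: "y \<in> \<Phi> \<omega>"
      obtain z where z: "z \<in> integer_points" "y \<in> unit_cube z" using ex_unit_cube by blast
      let ?S = "{(x, y). x \<in> \<Phi> \<omega> \<and> y \<in> \<Phi> \<omega> \<and> x \<in> UNIV \<and> y \<in> unit_cube z \<and> R (\<Phi> \<omega>) x y}"
      have "ecard ?S \<noteq> \<infinity>"
        using elim z(1) by (auto simp: mass_def)
      then have "finite ?S"
        by (auto simp: emeasure_count_space split: if_splits)
      moreover have "{x \<in> \<Phi> \<omega>. R (\<Phi> \<omega>) x y} \<subseteq> fst ` ?S"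
        using y z(2) by force
      ultimately show "finite {x \<in> \<Phi> \<omega>. R (\<Phi> \<omega>) x y}"
        by (meson finite_imageI finite_subset)
    qed
  qed
qed

text \<open>
  Arbitrary out-degrees are allowed here, because the relation can be restricted to the points of
  out-degree at most \<open>N\<close>, which gives a bounded transport for every \<open>N\<close>.
\<close>

lemma AE_finite_in_degree:
  assumes fin: "intensity M \<Phi> < \<infinity>" and R: "adapted_rel R"
  shows "AE \<omega> in M. \<forall>N. \<forall>y\<in>\<Phi> \<omega>.
    finite {x \<in> \<Phi> \<omega>. R (\<Phi> \<omega>) x y \<and> ecard {z \<in> \<Phi> \<omega>. R (\<Phi> \<omega>) x z} \<le> of_nat N}"
proof (subst AE_all_countable, intro allI AE_finite_in_degree_bounded[OF fin])
  fix N
  show "adapted_rel (\<lambda>\<phi> x y. R \<phi> x y \<and> ecard {z \<in> \<phi>. R \<phi> x z} \<le> of_nat N)"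
    by (intro adapted_rel_conj R adapted_rel_fst adapted_pred_out_degree_le)
  show "ecard {y \<in> \<phi>. R \<phi> x y \<and> ecard {z \<in> \<phi>. R \<phi> x z} \<le> of_nat N} \<le> of_nat N" for \<phi> x
    by (cases "ecard {z \<in> \<phi>. R \<phi> x z} \<le> of_nat N") auto
qed

text \<open>
  If \<open>S\<close> selected a finite nonempty subset \<open>T\<close> of an infinite class, then
  each point of the class could send mass to all points of \<open>T\<close>. The out-degree is the
  cardinality of \<open>T\<close> for all points of the class, so the points of \<open>T\<close>
  would have infinite in-degree.
\<close>

lemma AE_no_finite_selection:
  assumes fin: "intensity M \<Phi> < \<infinity>" and K: "adapted_rel K" and S: "adapted_pred S"
    and sym: "\<And>\<phi>. symp (K \<phi>)" and trans: "\<And>\<phi>. transp (K \<phi>)"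
  shows "AE \<omega> in M. \<forall>x\<in>\<Phi> \<omega>. S (\<Phi> \<omega>) x \<longrightarrow> infinite {y \<in> \<Phi> \<omega>. K (\<Phi> \<omega>) x y} \<longrightarrow>
    infinite {y \<in> \<Phi> \<omega>. K (\<Phi> \<omega>) x y \<and> S (\<Phi> \<omega>) y}"
proof -
  let ?R = "\<lambda>\<phi> x y. K \<phi> x y \<and> S \<phi> y"
  have "adapted_rel ?R"
    by (intro adapted_rel_conj K adapted_rel_converse[OF adapted_rel_fst] S)
  from AE_finite_in_degree[OF fin this] show ?thesis
  proof eventually_elim
    case (elim \<omega>)
    let ?\<phi> = "\<Phi> \<omega>"
    show ?case
    proof (intro ballI impI notI)
      fix x assume x: "x \<in> ?\<phi>" "S ?\<phi> x" "infinite {y \<in> ?\<phi>. K ?\<phi> x y}"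
        and T: "finite {y \<in> ?\<phi>. K ?\<phi> x y \<and> S ?\<phi> y}" (is "finite ?T")
      have "{y \<in> ?\<phi>. K ?\<phi> x y} \<subseteq> {w \<in> ?\<phi>. ?R ?\<phi> w x \<and> ecard {z \<in> ?\<phi>. ?R ?\<phi> w z} \<le> of_nat (card ?T)}"
      proof clarify
        fix w assume w: "w \<in> ?\<phi>" "K ?\<phi> x w"
        then have wx: "K ?\<phi> w x" using sym[of ?\<phi>] by (simp add: symp_def)
        have "{z \<in> ?\<phi>. ?R ?\<phi> w z} = ?T"
          using w(2) wx trans[of ?\<phi>] unfolding transp_def by blast
        then show "(K ?\<phi> w x \<and> S ?\<phi> x) \<and> ecard {z \<in> ?\<phi>. ?R ?\<phi> w z} \<le> of_nat (card ?T)"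
          using wx x(2) T by (simp add: ecard_le_iff)
      qed
      then show False
        using elim x(1,3) finite_subset by blast
    qed
  qed
qed

text \<open>
  Let every point with property \<open>S\<close> send unit mass to its image. By surjectivity a cube
  receives at least as much mass as it sends. The expectations agree and are finite, so the masses
  agree almost surely, and a surjection between finite sets of equal size is injective.
\<close>

lemma AE_inj_of_surj:
  fixes F :: "'a set \<Rightarrow> 'a \<Rightarrow> 'a"
  assumes fin: "intensity M \<Phi> < \<infinity>" and F: "adapted_rel (\<lambda>\<phi> x y. F \<phi> x = y)" and S: "adapted_pred S"
    and surj: "AE \<omega> in M. F (\<Phi> \<omega>) ` {x \<in> \<Phi> \<omega>. S (\<Phi> \<omega>) x} = {x \<in> \<Phi> \<omega>. S (\<Phi> \<omega>) x}"
  shows "AE \<omega> in M. inj_on (F (\<Phi> \<omega>)) {x \<in> \<Phi> \<omega>. S (\<Phi> \<omega>) x}"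
proof -
  let ?R = "\<lambda>\<phi> x y. F \<phi> x = y \<and> S \<phi> x"
  have R: "adapted_rel ?R"
    by (intro adapted_rel_conj F adapted_rel_fst S)
  have deg: "ecard {y \<in> \<phi>. ?R \<phi> x y} \<le> of_nat 1" for \<phi> x
  proof -
    have "ecard {y \<in> \<phi>. ?R \<phi> x y} \<le> ecard {F \<phi> x}"
      by (intro emeasure_mono) auto
    then show ?thesis by simp
  qed
  \<comment> \<open>the points in the cube, and the points that send their mass to the cube\<close>
  let ?A = "\<lambda>\<phi> z. {x \<in> \<phi>. S \<phi> x \<and> x \<in> unit_cube z}"
  let ?B = "\<lambda>\<phi> z. {x \<in> \<phi>. S \<phi> x \<and> F \<phi> x \<in> unit_cube z}"
  have image: "F \<phi> ` ?B \<phi> z = ?A \<phi> z" and outgoing: "mass ?R \<phi> (unit_cube z) UNIV = ecard (?A \<phi> z)"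
    and incoming: "mass ?R \<phi> UNIV (unit_cube z) = ecard (?B \<phi> z)"
    if s: "F \<phi> ` {x \<in> \<phi>. S \<phi> x} = {x \<in> \<phi>. S \<phi> x}" for \<phi> z
  proof -
    have cl: "F \<phi> x \<in> \<phi> \<and> S \<phi> (F \<phi> x)" if "x \<in> \<phi>" "S \<phi> x" for x
      using s that by blast
    show "F \<phi> ` ?B \<phi> z = ?A \<phi> z"
    proof
      show "F \<phi> ` ?B \<phi> z \<subseteq> ?A \<phi> z" by (auto dest: cl)
      show "?A \<phi> z \<subseteq> F \<phi> ` ?B \<phi> z"
      proof
        fix y assume y: "y \<in> ?A \<phi> z"
        then have "y \<in> F \<phi> ` {x \<in> \<phi>. S \<phi> x}" by (simp add: s)
        with y show "y \<in> F \<phi> ` ?B \<phi> z" by auto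
      qed
    qed
    have graph: "ecard ((\<lambda>x. (x, F \<phi> x)) ` X) = ecard X" for X
      by (rule ecard_bij[OF inj_on_imp_bij_betw, symmetric]) (simp add: inj_on_def)
    have "{(x, y). x \<in> \<phi> \<and> y \<in> \<phi> \<and> x \<in> unit_cube z \<and> y \<in> UNIV \<and> ?R \<phi> x y} = (\<lambda>x. (x, F \<phi> x)) ` ?A \<phi> z"
      by (auto simp: cl)
    then show "mass ?R \<phi> (unit_cube z) UNIV = ecard (?A \<phi> z)"
      by (simp only: mass_def graph)
    have "{(x, y). x \<in> \<phi> \<and> y \<in> \<phi> \<and> x \<in> UNIV \<and> y \<in> unit_cube z \<and> ?R \<phi> x y} = (\<lambda>x. (x, F \<phi> x)) ` ?B \<phi> z"
      by (auto simp: cl)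
    then show "mass ?R \<phi> UNIV (unit_cube z) = ecard (?B \<phi> z)"
      by (simp only: mass_def graph)
  qed
  have "AE \<omega> in M. mass ?R (\<Phi> \<omega>) (unit_cube z) UNIV = mass ?R (\<Phi> \<omega>) UNIV (unit_cube z)" for z
  proof (rule AE_eq_of_le_of_nn_integral_eq)
    show "AE \<omega> in M. mass ?R (\<Phi> \<omega>) (unit_cube z) UNIV \<le> mass ?R (\<Phi> \<omega>) UNIV (unit_cube z)"
      using surj
    proof eventually_elim
      case (elim \<omega>)
      show ?case
        unfolding outgoing[OF elim] incoming[OF elim]
        unfolding image[OF elim, symmetric]
        by (auto simp: emeasure_count_space card_image_le)
    qed
    show "(\<integral>\<^sup>+\<omega>. mass ?R (\<Phi> \<omega>) (unit_cube z) UNIV \<partial>M) \<noteq> \<infinity>"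
      by (rule nn_integral_mass_finite[OF fin deg])
  qed (use R mass_transport[OF R] in auto)
  then have "AE \<omega> in M. \<forall>z\<in>integer_points. mass ?R (\<Phi> \<omega>) (unit_cube z) UNIV = mass ?R (\<Phi> \<omega>) UNIV (unit_cube z)"
    by (subst AE_ball_countable[OF countable_integer_points]) auto
  then show ?thesis
    using surj AE_space
  proof eventually_elim
    case (elim \<omega>)
    show ?case
    proof (rule inj_onI)
      fix x x' assume x: "x \<in> {x \<in> \<Phi> \<omega>. S (\<Phi> \<omega>) x}" "x' \<in> {x \<in> \<Phi> \<omega>. S (\<Phi> \<omega>) x}" "F (\<Phi> \<omega>) x = F (\<Phi> \<omega>) x'"
      obtain z where z: "z \<in> integer_points" "F (\<Phi> \<omega>) x \<in> unit_cube z" using ex_unit_cube by blast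
      have eq: "ecard (?A (\<Phi> \<omega>) z) = ecard (?B (\<Phi> \<omega>) z)"
        using elim(1) z(1) unfolding outgoing[OF elim(2)] incoming[OF elim(2)] by blast
      have "unit_cube z \<subseteq> cbox z (z + One)"
        by (auto simp: unit_cube_def mem_box inner_add_left less_imp_le)
      then have "bounded (unit_cube z)"
        by (rule bounded_subset[OF bounded_cbox])
      then have "finite (\<Phi> \<omega> \<inter> unit_cube z)"
        using process_configs[OF elim(3)] by (simp add: configs_def)
      then have "finite (?A (\<Phi> \<omega>) z)"
        by (rule rev_finite_subset) auto
      with eq have "finite (?B (\<Phi> \<omega>) z)" "card (?A (\<Phi> \<omega>) z) = card (?B (\<Phi> \<omega>) z)"
        by (auto simp: emeasure_count_space split: if_splits)
      then have "inj_on (F (\<Phi> \<omega>)) (?B (\<Phi> \<omega>) z)"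
        using image[OF elim(2)] by (intro eq_card_imp_inj_on) auto
      then show "x = x'"
        using x z(2) by (auto dest: inj_onD)
    qed
  qed
qed

end

section \<open>Flow-adapted relations of a point-shift\<close>

lemma point_shift_translate:
  "point_shift f (translate t \<phi>) (x - t) = point_shift f \<phi> x - t"
proof -
  have "translate (x - t) (translate t \<phi>) = translate x \<phi>"
    by (simp add: translate_def image_image)
  then show ?thesis by (simp add: point_shift_def)
qed

lemma funpow_point_shift_translate:
  "(point_shift f (translate t \<phi>) ^^ n) (x - t) = (point_shift f \<phi> ^^ n) x - t"
  by (induction n) (simp_all add: point_shift_translate)

text \<open>
  Relations such as \<open>(F \<phi> ^^ n) x = y\<close> agree with compositions of adapted
  relations only at points of the configuration, where the iterates stay in the configuration.
  Covariance holds everywhere.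
\<close>

lemma adapted_rel_cong:
  assumes R': "adapted_rel R'"
    and cov: "\<And>t \<phi> x y. R (translate t \<phi>) (x - t) (y - t) = R \<phi> x y"
    and eq: "\<And>\<phi> x y. \<phi> \<in> configs \<Longrightarrow> x \<in> \<phi> \<Longrightarrow> y \<in> \<phi> \<Longrightarrow> R \<phi> x y \<longleftrightarrow> R' \<phi> x y"
  shows "adapted_rel R"
proof (rule adapted_relI[where R = R and Q = "rel_at R'"])
  show "rel_at R i j \<phi> = rel_at R' i j \<phi>" if "\<phi> \<in> configs" for i j \<phi>
    using eq[OF that point_at_in point_at_in, of i j] by (auto simp: rel_at_def)
qed (rule cov adapted_relD(2)[OF R'])+

context
  fixes f :: "'a::euclidean_space set \<Rightarrow> 'a"
  assumes f: "point_map f"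
begin

lemma self_map_point_shift: "\<phi> \<in> configs \<Longrightarrow> self_map \<phi> (point_shift f \<phi>)"
  by (rule self_map.intro) (rule point_shift_in[OF f])

text \<open>
  The default value \<open>0\<close> extends the function from the configurations with an
  \<open>i\<close>-th isolated point, where the point-map is applied to a configuration with a point
  at the origin.
\<close>

lemma measurable_point_map_at_point:
  "(\<lambda>\<phi>. if isolates \<phi> i then f (translate (point_at \<phi> i) \<phi>) else 0) \<in> borel_measurable config_space"
proof -
  let ?D = "restrict_space config_space {\<phi>. isolates \<phi> i}"
  have "(\<lambda>\<phi>. translate (point_at \<phi> i) \<phi>) \<in> measurable ?D (restrict_space config_space configs0)"
  proof (rule measurable_restrict_space2)
    show "(\<lambda>\<phi>. translate (point_at \<phi> i) \<phi>) \<in> space ?D \<rightarrow> configs0"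
      using point_at_in by (auto simp: space_restrict_space configs0_def translate_configs) (force simp: translate_def)
  qed (rule measurable_restrict_space1[OF measurable_translate_point_at])
  moreover have "f \<in> measurable (restrict_space config_space configs0) borel"
    using f by (simp add: point_map_def)
  ultimately have "(\<lambda>\<phi>. f (translate (point_at \<phi> i) \<phi>)) \<in> borel_measurable ?D"
    by (rule measurable_compose)
  moreover have "{\<phi> \<in> space config_space. isolates \<phi> i} \<in> sets config_space"
    by measurable
  ultimately show ?thesis
    by (subst measurable_If_restrict_space_iff) auto
qed

lemma adapted_rel_point_shift: "adapted_rel (\<lambda>\<phi> x y. point_shift f \<phi> x = y)"
proof (rule adapted_relI[where Q = "\<lambda>i j \<phi>. isolates \<phi> i \<and> isolates \<phi> j \<and>
    (if isolates \<phi> i then f (translate (point_at \<phi> i) \<phi>) else 0) + point_at \<phi> i = point_at \<phi> j"])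
  note [measurable] = measurable_point_map_at_point
  show "Measurable.pred config_space (\<lambda>\<phi>. isolates \<phi> i \<and> isolates \<phi> j \<and>
      (if isolates \<phi> i then f (translate (point_at \<phi> i) \<phi>) else 0) + point_at \<phi> i = point_at \<phi> j)" for i j
    by measurable
  show "(point_shift f (translate t \<phi>) (x - t) = y - t) = (point_shift f \<phi> x = y)" for t \<phi> x y
    by (simp add: point_shift_translate)
qed (auto simp: rel_at_def point_shift_def)

lemma adapted_rel_funpow: "adapted_rel (\<lambda>\<phi> x y. (point_shift f \<phi> ^^ n) x = y)"
proof (induction n)
  case 0
  show ?case
  proof (rule adapted_relI[where Q = "\<lambda>i j \<phi>. isolates \<phi> i \<and> isolates \<phi> j \<and> point_at \<phi> i = point_at \<phi> j"])
    show "Measurable.pred config_space (\<lambda>\<phi>. isolates \<phi> i \<and> isolates \<phi> j \<and> point_at \<phi> i = point_at \<phi> j)" for i j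
      by measurable
  qed (auto simp: rel_at_def)
next
  case (Suc n)
  show ?case
  proof (rule adapted_rel_cong[OF adapted_rel_comp[OF adapted_rel_point_shift Suc]])
    show "((point_shift f (translate t \<phi>) ^^ Suc n) (x - t) = y - t) = ((point_shift f \<phi> ^^ Suc n) x = y)" for t \<phi> x y
      unfolding funpow_point_shift_translate by simp
    show "((point_shift f \<phi> ^^ Suc n) x = y) \<longleftrightarrow> (\<exists>z\<in>\<phi>. point_shift f \<phi> x = z \<and> (point_shift f \<phi> ^^ n) z = y)"
      if "\<phi> \<in> configs" "x \<in> \<phi>" for \<phi> x y
      using self_map.closed[OF self_map_point_shift] that by (auto simp: funpow_swap1)
  qed
qed

lemma adapted_rel_coincide: "adapted_rel (\<lambda>\<phi> x y. (point_shift f \<phi> ^^ m) x = (point_shift f \<phi> ^^ n) y)"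
proof (rule adapted_rel_cong[OF adapted_rel_comp[OF adapted_rel_funpow adapted_rel_converse[OF adapted_rel_funpow], of m n]])
  show "((point_shift f \<phi> ^^ m) x = (point_shift f \<phi> ^^ n) y) \<longleftrightarrow> (\<exists>z\<in>\<phi>. (point_shift f \<phi> ^^ m) x = z \<and> (point_shift f \<phi> ^^ n) y = z)"
    if "\<phi> \<in> configs" "x \<in> \<phi>" for \<phi> x y
    using self_map.funpow_closed[OF self_map_point_shift] that by auto
qed (simp add: funpow_point_shift_translate)

lemma adapted_rel_connected_by: "adapted_rel (\<lambda>\<phi>. connected_by (point_shift f \<phi>))"
  unfolding connected_by_def by (intro adapted_rel_ex_nat adapted_rel_coincide)

lemma adapted_rel_coalesce: "adapted_rel (\<lambda>\<phi>. coalesce (point_shift f \<phi>))"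
  unfolding coalesce_def by (intro adapted_rel_ex_nat adapted_rel_coincide)

lemma adapted_pred_ancient: "adapted_pred (\<lambda>\<phi>. ancient \<phi> (point_shift f \<phi>))"
  unfolding ancient_def by (intro adapted_pred_all_nat adapted_pred_ex adapted_rel_converse[OF adapted_rel_funpow])

lemma adapted_pred_cyclic: "adapted_pred (\<lambda>\<phi> x. \<exists>n. (point_shift f \<phi> ^^ Suc n) x = x)"
  by (intro adapted_pred_ex_nat adapted_pred_diag[OF adapted_rel_funpow])

lemma adapted_pred_finite_foil: "adapted_pred (\<lambda>\<phi> x. finite (foil \<phi> (point_shift f \<phi>) x))"
  unfolding foil_def by (intro adapted_pred_finite adapted_rel_coalesce)

lemma adapted_rel_image_coalesce: "adapted_rel (\<lambda>\<phi> x y. coalesce (point_shift f \<phi>) (point_shift f \<phi> x) y)"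
proof (rule adapted_rel_cong[OF adapted_rel_comp[OF adapted_rel_point_shift adapted_rel_coalesce]])
  show "coalesce (point_shift f (translate t \<phi>)) (point_shift f (translate t \<phi>) (x - t)) (y - t) = coalesce (point_shift f \<phi>) (point_shift f \<phi> x) y" for t \<phi> x y
    unfolding point_shift_translate by (rule adapted_relD(1)[OF adapted_rel_coalesce])
  show "coalesce (point_shift f \<phi>) (point_shift f \<phi> x) y \<longleftrightarrow> (\<exists>z\<in>\<phi>. point_shift f \<phi> x = z \<and> coalesce (point_shift f \<phi>) z y)"
    if "\<phi> \<in> configs" "x \<in> \<phi>" for \<phi> x y
    using self_map.closed[OF self_map_point_shift] that by auto
qed

lemma adapted_pred_last_finite_foil:
  "adapted_pred (\<lambda>\<phi> x. finite (foil \<phi> (point_shift f \<phi>) x) \<and> infinite (foil \<phi> (point_shift f \<phi>) (point_shift f \<phi> x)))"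
proof (intro adapted_pred_conj adapted_pred_finite_foil adapted_pred_not)
  show "adapted_pred (\<lambda>\<phi> x. finite (foil \<phi> (point_shift f \<phi>) (point_shift f \<phi> x)))"
    unfolding foil_def by (intro adapted_pred_finite adapted_rel_image_coalesce)
qed

lemma adapted_pred_first_finite_foil:
  "adapted_pred (\<lambda>\<phi> x. finite (foil \<phi> (point_shift f \<phi>) x) \<and> \<not> (\<exists>z\<in>\<phi>. coalesce (point_shift f \<phi>) x (point_shift f \<phi> z)))"
proof (intro adapted_pred_conj adapted_pred_finite_foil adapted_pred_not adapted_pred_ex)
  have "coalesce (point_shift f \<phi>) x (point_shift f \<phi> z) = coalesce (point_shift f \<phi>) (point_shift f \<phi> z) x" for \<phi> x z
    by (metis coalesce_sym)
  then show "adapted_rel (\<lambda>\<phi> x z. coalesce (point_shift f \<phi>) x (point_shift f \<phi> z))"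
    using adapted_rel_converse[OF adapted_rel_image_coalesce] by simp
qed

end

text \<open>
  The exceptional events are null sets by the consequences of the mass transport principle. The
  transport used for \<open>finite_foil_of_lone_ancient\<close> sends mass from each point to the
  ancient points of its foil, and there is only one such point in the case at hand.
\<close>

lemma (in stationary_point_process) AE_regular_map:
  assumes fin: "intensity M \<Phi> < \<infinity>" and f: "point_map f"
  shows "AE \<omega> in M. regular_map (\<Phi> \<omega>) (point_shift f (\<Phi> \<omega>))"
proof -
  let ?F = "\<lambda>\<omega>. point_shift f (\<Phi> \<omega>)"
  have sym: "symp (connected_by (point_shift f \<phi>))" and trans: "transp (connected_by (point_shift f \<phi>))" for \<phi>
    by (auto intro: sympI transpI connected_by_sym connected_by_trans)
  note selection = AE_no_finite_selection[OF fin adapted_rel_connected_by[OF f] _ sym trans]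
  have fibres: "AE \<omega> in M. \<forall>y\<in>\<Phi> \<omega>. finite {x \<in> \<Phi> \<omega>. ?F \<omega> x = y}"
  proof (rule AE_finite_in_degree_bounded[OF fin adapted_rel_point_shift[OF f]])
    show "ecard {y \<in> \<phi>. point_shift f \<phi> x = y} \<le> of_nat 1" for \<phi> x
      using emeasure_mono[of "{y \<in> \<phi>. point_shift f \<phi> x = y}" "{point_shift f \<phi> x}" "count_space UNIV"]
      by auto
  qed
  have inj: "AE \<omega> in M. inj_on (?F \<omega>) {y \<in> \<Phi> \<omega>. ancient (\<Phi> \<omega>) (?F \<omega>) y}"
  proof (rule AE_inj_of_surj[OF fin adapted_rel_point_shift[OF f] adapted_pred_ancient[OF f]])
    show "AE \<omega> in M. ?F \<omega> ` {y \<in> \<Phi> \<omega>. ancient (\<Phi> \<omega>) (?F \<omega>) y} = {y \<in> \<Phi> \<omega>. ancient (\<Phi> \<omega>) (?F \<omega>) y}"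
      using fibres AE_space
      by eventually_elim (intro self_map.image_ancient self_map_point_shift[OF f] process_configs; simp)
  qed
  have "adapted_rel (\<lambda>\<phi> x y. coalesce (point_shift f \<phi>) x y \<and> ancient \<phi> (point_shift f \<phi>) y)"
    by (intro adapted_rel_conj adapted_rel_coalesce[OF f] adapted_rel_converse[OF adapted_rel_fst] adapted_pred_ancient[OF f])
  note lone = AE_finite_in_degree[OF fin this]
  show ?thesis
    using fibres inj lone selection[OF adapted_pred_cyclic[OF f]] selection[OF adapted_pred_last_finite_foil[OF f]]
      selection[OF adapted_pred_first_finite_foil[OF f]] AE_space
  proof eventually_elim
    case (elim \<omega>)
    show ?case
    proof (intro regular_map.intro regular_map_axioms.intro)
      show "self_map (\<Phi> \<omega>) (?F \<omega>)"
        using process_configs[OF elim(7)] by (rule self_map_point_shift[OF f])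
      show "inj_on (?F \<omega>) {y \<in> \<Phi> \<omega>. ancient (\<Phi> \<omega>) (?F \<omega>) y}"
        by (rule elim(2))
      show "finite {x \<in> \<Phi> \<omega>. ?F \<omega> x = y}" if "y \<in> \<Phi> \<omega>" for y
        using elim(1) that by blast
    next
      fix y
      assume y: "y \<in> \<Phi> \<omega>" "ancient (\<Phi> \<omega>) (?F \<omega>) y"
        and lone: "\<And>z. z \<in> \<Phi> \<omega> \<Longrightarrow> coalesce (?F \<omega>) y z \<Longrightarrow> ancient (\<Phi> \<omega>) (?F \<omega>) z \<Longrightarrow> z = y"
      let ?R = "\<lambda>x y. coalesce (?F \<omega>) x y \<and> ancient (\<Phi> \<omega>) (?F \<omega>) y"
      have "foil (\<Phi> \<omega>) (?F \<omega>) y \<subseteq> {x \<in> \<Phi> \<omega>. ?R x y \<and> ecard {z \<in> \<Phi> \<omega>. ?R x z} \<le> of_nat 1}"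
      proof
        fix x assume "x \<in> foil (\<Phi> \<omega>) (?F \<omega>) y"
        then have x: "x \<in> \<Phi> \<omega>" "coalesce (?F \<omega>) y x" by (auto simp: foil_def)
        have "{z \<in> \<Phi> \<omega>. ?R x z} \<subseteq> {y}"
          using lone coalesce_trans[OF x(2)] by blast
        then have "ecard {z \<in> \<Phi> \<omega>. ?R x z} \<le> ecard {y}"
          by (intro emeasure_mono) auto
        then show "x \<in> {x \<in> \<Phi> \<omega>. ?R x y \<and> ecard {z \<in> \<Phi> \<omega>. ?R x z} \<le> of_nat 1}"
          using x(1) y(2) coalesce_sym[OF x(2)] by simp
      qed
      moreover have "finite {x \<in> \<Phi> \<omega>. ?R x y \<and> ecard {z \<in> \<Phi> \<omega>. ?R x z} \<le> of_nat 1}"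
        using elim(3) y(1) by blast
      ultimately show "finite (foil (\<Phi> \<omega>) (?F \<omega>) y)"
        by (rule finite_subset)
    qed (use elim(4-6) in \<open>simp_all add: component_def\<close>)
  qed
qed

section \<open>The classification of the components\<close>

theorem theorem21:
  fixes M :: "'w measure"
    and \<theta> :: "'a::euclidean_space \<Rightarrow> 'w \<Rightarrow> 'w"
    and \<Phi> :: "'w \<Rightarrow> 'a set"
    and f :: "'a set \<Rightarrow> 'a"
  assumes "stationary_point_process M \<theta> \<Phi>"
    and "0 < intensity M \<Phi>" and "intensity M \<Phi> < \<infinity>"
    and "point_map f"
  shows "AE \<omega> in M. \<forall>C \<in> shift_components f (\<Phi> \<omega>).
    (class_FF f (\<Phi> \<omega>) C \<or> class_IF f (\<Phi> \<omega>) C \<or> class_II f (\<Phi> \<omega>) C) \<and>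
    (class_FF f (\<Phi> \<omega>) C \<longrightarrow>
       (\<forall>L \<in> foils_of f (\<Phi> \<omega>) C. finite L) \<and>
       finite (foils_of f (\<Phi> \<omega>) C) \<and> 1 \<le> card (foils_of f (\<Phi> \<omega>) C) \<and>
       (\<exists>p. is_cycle_of f (\<Phi> \<omega>) C p \<and>
            (\<forall>q. is_cycle_of f (\<Phi> \<omega>) C q \<longrightarrow> (\<exists>k. q = rotate k p)) \<and>
            length p = card (foils_of f (\<Phi> \<omega>) C) \<and>
            F_infinity f (\<Phi> \<omega>) C = tail (shift_graph f (\<Phi> \<omega>)) ` set p)) \<and>
    (class_IF f (\<Phi> \<omega>) C \<longrightarrow>
       acyclic_component f (\<Phi> \<omega>) C \<and>
       (\<forall>L \<in> foils_of f (\<Phi> \<omega>) C. \<exists>L' \<in> foils_of f (\<Phi> \<omega>) C.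
          \<forall>y \<in> L'. point_shift f (\<Phi> \<omega>) y \<in> L) \<and>
       (\<exists>x. bi_infinite_path f (\<Phi> \<omega>) x \<and> F_infinity f (\<Phi> \<omega>) C = range x \<and>
            (\<forall>z. bi_infinite_path f (\<Phi> \<omega>) z \<and> range z \<subseteq> C \<longrightarrow>
               (\<exists>k. \<forall>n. z n = x (n + k))))) \<and>
    (class_II f (\<Phi> \<omega>) C \<longrightarrow>
       acyclic_component f (\<Phi> \<omega>) C \<and>
       F_infinity f (\<Phi> \<omega>) C = {})"
proof -
  interpret stationary_point_process M \<theta> \<Phi> by fact
  show ?thesis
    using AE_regular_map[OF assms(3,4)]
    by eventually_elim (intro ballI regular_classification)
qed

end
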